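(* Let $G \preceq H$ be graphs (with $G$ an elementary substructure of $H$), both monadically stable, and let $u, v \in V(H) \setminus V(G)$. Then $u \mathrel{\smile\!\!\!\!|}^{f}_{G} v$ (forking independence of $u$ and $v$ over $G$) holds if and only if $u \mathrel{\smile\!\!\!\!|}^{r}_{G} v$ holds for every $r \in \mathbb{N}$.
   Context: Graphs are viewed as structures with one symmetric irreflexive binary relation $E$. A class $\mathcal C$ of structures is monadically stable if there is no formula $\phi(\bar x,\bar y)$ in the language of $\mathcal C$ expanded by unary predicates such that for every $n$ there exist $\mathbf A\in\mathcal C$, an expansion $\widehat{\mathbf A}$ of $\mathbf A$ by unary predicates, and tuples $\bar v_1,\dots,\bar v_n$ with $\widehat{\mathbf A}\models\phi(\bar v_i,\bar v_j)\iff i\le j$; a single structure (graph) is monadically stable if the class consisting of it is. Forking independence $u \mathrel{\smile\!\!\!\!|}^{f}_{G} v$ means $\mathrm{tp}(u/V(G)\cup\{v\})$ does not fork over $V(G)$; in stable structures over an elementary substructure this is equivalent to: for every first-order formula $\phi(x,y)$ with parameters from $V(G)$ such that $H\models\phi(u,v)$ there is $u'\in V(G)$ with $H\models \phi(u',v)$. For a finite set $S\subseteq V(H)$, the atomic type of a vertex $w$ over $S$ records, for each $s\in S$, whether $w=s$ and whether $w$ is adjacent to $s$. An $S$-definable flip of $H$ is a graph $H'$ on $V(H)$ such that, letting $\mathcal P$ be the partition of $V(H)$ into classes of vertices with equal atomic type over $S$, for every pair of (not necessarily distinct) parts $A,B\in\mathcal P$ either $H\models E(a,b)\iff H'\models E(a,b)$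 for all distinct $a\in A,b\in B$, or $H\models E(a,b)\iff H'\not\models E(a,b)$ for all distinct $a\in A,b\in B$. Flip independence: $u \mathrel{\smile\!\!\!\!|}^{r}_{G} v$ means there is a finite set $S\subseteq V(G)$ and an $S$-definable flip $H'$ of $H$ with $\mathrm{dist}_{H'}(u,v)>r$ (distances in $H'$, with $\mathrm{dist}(u,u)=0$). *)

theory Defs
  imports Main "HOL-Library.Extended_Nat"
begin

record 'a graph =
  verts :: "'a set"
  adj :: "'a \<Rightarrow> 'a \<Rightarrow> bool"

definition is_graph :: "'a graph \<Rightarrow> bool" where
  "is_graph G \<longleftrightarrow>
     (\<forall>x y. adj G x y \<longrightarrow> x \<in> verts G \<and> y \<in> verts G) \<and>
     (\<forall>x y. adj G x y \<longrightarrow> adj G y x) \<and>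
     (\<forall>x. \<not> adj G x x)"

text \<open>First-order formulas over equality, the edge relation and unary predicate symbols
  \<open>P\<^sub>0, P\<^sub>1, \<dots>\<close>. Variables are de Bruijn indices: they are looked up in a list of vertices, and
  the quantifier binds index 0. The language of graphs consists of the formulas
  satisfying \<open>pure_fm\<close>.\<close>

datatype fm =
    FEq nat nat
  | FEdge nat nat
  | FPred nat nat
  | FNot fm
  | FAnd fm fm
  | FEx fm

text \<open>\<open>vars_below n \<phi>\<close>: all free variables of \<open>\<phi>\<close> are among \<open>0, \<dots>, n - 1\<close>.\<close>

fun vars_below :: "nat \<Rightarrow> fm \<Rightarrow> bool" where
  "vars_below n (FEq i j) \<longleftrightarrow> i < n \<and> j < n"
| "vars_below n (FEdge i j) \<longleftrightarrow> i < n \<and> j < n"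
| "vars_below n (FPred k i) \<longleftrightarrow> i < n"
| "vars_below n (FNot \<phi>) \<longleftrightarrow> vars_below n \<phi>"
| "vars_below n (FAnd \<phi> \<psi>) \<longleftrightarrow> vars_below n \<phi> \<and> vars_below n \<psi>"
| "vars_below n (FEx \<phi>) \<longleftrightarrow> vars_below (Suc n) \<phi>"

fun pure_fm :: "fm \<Rightarrow> bool" where
  "pure_fm (FEq i j) \<longleftrightarrow> True"
| "pure_fm (FEdge i j) \<longleftrightarrow> True"
| "pure_fm (FPred k i) \<longleftrightarrow> False"
| "pure_fm (FNot \<phi>) \<longleftrightarrow> pure_fm \<phi>"
| "pure_fm (FAnd \<phi> \<psi>) \<longleftrightarrow> pure_fm \<phi> \<and> pure_fm \<psi>"
| "pure_fm (FEx \<phi>) \<longleftrightarrow> pure_fm \<phi>"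

text \<open>Satisfaction in the expansion of \<open>G\<close> by the unary predicates \<open>P\<close>.\<close>

fun sat :: "'a graph \<Rightarrow> (nat \<Rightarrow> 'a set) \<Rightarrow> 'a list \<Rightarrow> fm \<Rightarrow> bool" where
  "sat G P e (FEq i j) \<longleftrightarrow> e ! i = e ! j"
| "sat G P e (FEdge i j) \<longleftrightarrow> adj G (e ! i) (e ! j)"
| "sat G P e (FPred k i) \<longleftrightarrow> e ! i \<in> P k"
| "sat G P e (FNot \<phi>) \<longleftrightarrow> \<not> sat G P e \<phi>"
| "sat G P e (FAnd \<phi> \<psi>) \<longleftrightarrow> sat G P e \<phi> \<and> sat G P e \<psi>"
| "sat G P e (FEx \<phi>) \<longleftrightarrow> (\<exists>a\<in>verts G. sat G P (a # e) \<phi>)"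

text \<open>Satisfaction in the graph itself; only used for \<open>pure_fm\<close> formulas, for which the
  choice of \<open>P\<close> is irrelevant.\<close>

definition holds :: "'a graph \<Rightarrow> 'a list \<Rightarrow> fm \<Rightarrow> bool" where
  "holds G e \<phi> \<longleftrightarrow> sat G (\<lambda>_. {}) e \<phi>"

definition elementary_embedding :: "('a \<Rightarrow> 'b) \<Rightarrow> 'a graph \<Rightarrow> 'b graph \<Rightarrow> bool" where
  "elementary_embedding f G H \<longleftrightarrow>
     f ` verts G \<subseteq> verts H \<and>
     (\<forall>\<phi> e. pure_fm \<phi> \<and> vars_below (length e) \<phi> \<and> set e \<subseteq> verts G \<longrightarrow>
        (holds G e \<phi> \<longleftrightarrow> holds H (map f e) \<phi>))"

definition elementary_substructure :: "'a graph \<Rightarrow> 'a graph \<Rightarrow> bool" where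
  "elementary_substructure G H \<longleftrightarrow>
     verts G \<subseteq> verts H \<and>
     (\<forall>\<phi> e. pure_fm \<phi> \<and> vars_below (length e) \<phi> \<and> set e \<subseteq> verts G \<longrightarrow>
        (holds G e \<phi> \<longleftrightarrow> holds H e \<phi>))"

text \<open>In \<open>\<phi>(x, y)\<close> both tuples have the same length \<open>m\<close>; the variables of the first are
  \<open>0, \<dots>, m - 1\<close> and those of the second \<open>m, \<dots>, 2 m - 1\<close>.\<close>

definition monadically_stable_class :: "'a graph set \<Rightarrow> bool" where
  "monadically_stable_class \<C> \<longleftrightarrow>
     \<not> (\<exists>\<phi> m. vars_below (2 * m) \<phi> \<and>
          (\<forall>n::nat. \<exists>G\<in>\<C>. \<exists>P v.
             (\<forall>k. P k \<subseteq> verts G) \<and>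
             (\<forall>i<n. length (v i) = m \<and> set (v i) \<subseteq> verts G) \<and>
             (\<forall>i<n. \<forall>j<n. sat G P (v i @ v j) \<phi> \<longleftrightarrow> i \<le> j)))"

definition monadically_stable :: "'a graph \<Rightarrow> bool" where
  "monadically_stable G \<longleftrightarrow> monadically_stable_class {G}"

text \<open>Formulas \<open>\<phi>(x, b)\<close> in one variable \<open>x\<close> with a parameter tuple \<open>b\<close> are represented by
  pairs \<open>(\<phi>, b)\<close>: variable 0 is \<open>x\<close> and variable \<open>i + 1\<close> is \<open>b ! i\<close>.\<close>

definition param_fms :: "'a set \<Rightarrow> (fm \<times> 'a list) set" where
  "param_fms B = {(\<phi>, b). pure_fm \<phi> \<and> vars_below (Suc (length b)) \<phi> \<and> set b \<subseteq> B}"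

definition tp :: "'a graph \<Rightarrow> 'a set \<Rightarrow> 'a \<Rightarrow> (fm \<times> 'a list) set" where
  "tp H B u = {(\<phi>, b) \<in> param_fms B. holds H (u # b) \<phi>}"

definition same_type_over :: "'a graph \<Rightarrow> 'a set \<Rightarrow> 'a list \<Rightarrow> 'a list \<Rightarrow> bool" where
  "same_type_over N A c d \<longleftrightarrow>
     length c = length d \<and>
     (\<forall>\<phi> a. pure_fm \<phi> \<and> set a \<subseteq> A \<and> vars_below (length c + length a) \<phi> \<longrightarrow>
        (holds N (c @ a) \<phi> \<longleftrightarrow> holds N (d @ a) \<phi>))"

text \<open>\<open>\<psi>(x, c)\<close> divides over \<open>A\<close>, witnessed by a sequence in \<open>N\<close>: there are tuples
  \<open>c\<^sub>0, c\<^sub>1, \<dots>\<close> with the same type over \<open>A\<close> as \<open>c\<close> such that the family of all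
  \<open>\<psi>(x, c\<^sub>i)\<close> is \<open>k\<close>-inconsistent for some \<open>k\<close>.\<close>

definition divides_in :: "'a graph \<Rightarrow> 'a set \<Rightarrow> fm \<times> 'a list \<Rightarrow> bool" where
  "divides_in N A = (\<lambda>(\<psi>, c).
     \<exists>d :: nat \<Rightarrow> 'a list. \<exists>k \<ge> 1.
       (\<forall>i. set (d i) \<subseteq> verts N \<and> same_type_over N A c (d i)) \<and>
       (\<forall>I. finite I \<and> card I = k \<longrightarrow>
          \<not> (\<exists>x\<in>verts N. \<forall>i\<in>I. holds N (x # d i) \<psi>)))"

text \<open>\<open>\<phi>(x, b)\<close> forks over \<open>A\<close> if it implies a finite disjunction of formulas, with
  parameters in a monster model, that divide over \<open>A\<close>. The disjuncts and the sequences
  witnessing dividing involve only countably many elements of the monster model, so by the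
  downward Loewenheim-Skolem theorem they all lie in an elementary extension \<open>N\<close> of
  \<open>H\<close> of cardinality at most \<open>|H| + \<aleph>\<^sub>0\<close>, and conversely every such \<open>N\<close> embeds into the
  monster model over \<open>H\<close>. Up to isomorphism over \<open>H\<close>, every such \<open>N\<close> lives on the
  type \<open>'a \<times> nat\<close>.\<close>

definition forks_over :: "'a graph \<Rightarrow> 'a set \<Rightarrow> fm \<times> 'a list \<Rightarrow> bool" where
  "forks_over H A = (\<lambda>(\<phi>, b).
     \<exists>(N :: ('a \<times> nat) graph) f \<Psi>.
       is_graph N \<and> elementary_embedding f H N \<and>
       finite \<Psi> \<and> \<Psi> \<subseteq> param_fms (verts N) \<and>
       (\<forall>q\<in>\<Psi>. divides_in N (f ` A) q) \<and>
       (\<forall>x\<in>verts N. holds N (x # map f b) \<phi> \<longrightarrow> (\<exists>(\<psi>, c)\<in>\<Psi>. holds N (x # c) \<psi>)))"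

definition type_forks_over :: "'a graph \<Rightarrow> 'a set \<Rightarrow> (fm \<times> 'a list) set \<Rightarrow> bool" where
  "type_forks_over H A p \<longleftrightarrow> (\<exists>q\<in>p. forks_over H A q)"

definition forking_indep :: "'a graph \<Rightarrow> 'a graph \<Rightarrow> 'a \<Rightarrow> 'a \<Rightarrow> bool" where
  "forking_indep G H u v \<longleftrightarrow>
     \<not> type_forks_over H (verts G) (tp H (verts G \<union> {v}) u)"

definition same_atomic_type :: "'a graph \<Rightarrow> 'a set \<Rightarrow> ('a \<times> 'a) set" where
  "same_atomic_type H S =
     {(w, w'). w \<in> verts H \<and> w' \<in> verts H \<and>
        (\<forall>s\<in>S. (w = s \<longleftrightarrow> w' = s) \<and> (adj H w s \<longleftrightarrow> adj H w' s))}"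

definition definable_flip :: "'a graph \<Rightarrow> 'a set \<Rightarrow> 'a graph \<Rightarrow> bool" where
  "definable_flip H S H' \<longleftrightarrow>
     is_graph H' \<and> verts H' = verts H \<and>
     (\<forall>A \<in> verts H // same_atomic_type H S. \<forall>B \<in> verts H // same_atomic_type H S.
        (\<forall>a\<in>A. \<forall>b\<in>B. a \<noteq> b \<longrightarrow> (adj H a b \<longleftrightarrow> adj H' a b)) \<or>
        (\<forall>a\<in>A. \<forall>b\<in>B. a \<noteq> b \<longrightarrow> (adj H a b \<longleftrightarrow> \<not> adj H' a b)))"

definition gdist :: "'a graph \<Rightarrow> 'a \<Rightarrow> 'a \<Rightarrow> enat" where
  "gdist H u v = (INF n \<in> {n. (adj H ^^ n) u v}. enat n)"

definition flip_indep :: "nat \<Rightarrow> 'a graph \<Rightarrow> 'a graph \<Rightarrow> 'a \<Rightarrow> 'a \<Rightarrow> bool" where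
  "flip_indep r G H u v \<longleftrightarrow>
     (\<exists>S H'. finite S \<and> S \<subseteq> verts G \<and> definable_flip H S H' \<and> gdist H' u v > enat r)"

end

theory Submission
  imports Defs "HOL-Library.Countable" "HOL-Library.Infinite_Set"
begin

text \<open>By stability the adjacency of \<open>w\<close> to \<open>G\<close> is given by atomic types over a finite subset of
  \<open>G\<close>, which predicts whether \<open>w\<close> should be adjacent to a further vertex \<open>x\<close>; the prediction is
  symmetric. Calling \<open>w\<close> and \<open>x\<close> linked if it fails yields a limit graph in which no vertex
  outside \<open>G\<close> is linked to \<open>G\<close>. Monadic stability forbids that a ball of finite radius in the limit
  graph has infinitely many traces on \<open>G\<close>, since these could be used to code pairs by single
  vertices. Hence each such ball is also a ball in a flip definable over a finite subset of \<open>G\<close>, and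
  in that flip it avoids \<open>G\<close>.

  If \<open>u\<close> and \<open>v\<close> are within distance \<open>r\<close> in a flip where \<open>v\<close> is farther than \<open>2 r\<close> from \<open>G\<close>, then
  a coheir sequence of copies of \<open>v\<close> over \<open>G\<close> consists of vertices pairwise farther than \<open>2 r\<close> apart,
  so that being within distance \<open>r\<close> of \<open>v\<close> divides over \<open>G\<close>. Conversely, if \<open>u\<close>, \<open>v\<close> and \<open>G\<close> are far
  from each other in a flip, then a vertex \<open>u'\<close> of \<open>G\<close> that resembles \<open>u\<close> can replace \<open>u\<close> in a
  formula over \<open>G\<close> and \<open>v\<close>: exchanging the neighbourhoods of \<open>u\<close> and \<open>u'\<close> wins the corresponding
  Ehrenfeucht-Fraisse game. So the type of \<open>u\<close> over \<open>G\<close> and \<open>v\<close> is finitely satisfiable in \<open>G\<close>.\<close>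


section \<open>Renaming of variables\<close>

fun ren :: "(nat \<Rightarrow> nat) \<Rightarrow> fm \<Rightarrow> fm" where
  "ren f (FEq i j) = FEq (f i) (f j)"
| "ren f (FEdge i j) = FEdge (f i) (f j)"
| "ren f (FPred k i) = FPred k (f i)"
| "ren f (FNot \<phi>) = FNot (ren f \<phi>)"
| "ren f (FAnd \<phi> \<psi>) = FAnd (ren f \<phi>) (ren f \<psi>)"
| "ren f (FEx \<phi>) = FEx (ren (case_nat 0 (\<lambda>i. Suc (f i))) \<phi>)"

lemma sat_ren:
  assumes "vars_below n \<phi>" and "\<And>i. i < n \<Longrightarrow> e ! i = e' ! f i"
  shows "sat K P e' (ren f \<phi>) \<longleftrightarrow> sat K P e \<phi>"
  using assms
proof (induction \<phi> arbitrary: n e e' f)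
  case (FEx \<phi>)
  have "sat K P (a # e') (ren (case_nat 0 (\<lambda>i. Suc (f i))) \<phi>) \<longleftrightarrow> sat K P (a # e) \<phi>" for a
    using FEx.prems by (intro FEx.IH[of "Suc n"]) (auto split: nat.split)
  then show ?case by simp
next
  case (FNot \<phi>)
  then show ?case by auto
next
  case (FAnd \<phi> \<psi>)
  then show ?case using FAnd.IH[of n e e' f] by auto
qed auto

lemma vars_below_ren:
  assumes "vars_below n \<phi>" and "\<And>i. i < n \<Longrightarrow> f i < m"
  shows "vars_below m (ren f \<phi>)"
  using assms
proof (induction \<phi> arbitrary: n m f)
  case (FEx \<phi>)
  have "vars_below (Suc m) (ren (case_nat 0 (\<lambda>i. Suc (f i))) \<phi>)"
    using FEx.prems by (intro FEx.IH[of "Suc n"]) (auto split: nat.split)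
  then show ?case by simp
qed auto

lemma pure_ren [simp]: "pure_fm (ren f \<phi>) \<longleftrightarrow> pure_fm \<phi>"
  by (induction \<phi> arbitrary: f) auto

lemma sat_coincidence:
  assumes "vars_below n \<phi>" and "\<And>i. i < n \<Longrightarrow> e ! i = e' ! i"
  shows "sat K P e' \<phi> \<longleftrightarrow> sat K P e \<phi>"
  using assms
proof (induction \<phi> arbitrary: n e e')
  case (FEx \<phi>)
  have "sat K P (a # e') \<phi> \<longleftrightarrow> sat K P (a # e) \<phi>" for a
    using FEx.prems by (intro FEx.IH[of "Suc n"]) (auto simp: nth_Cons split: nat.split)
  then show ?case by simp
next
  case (FNot \<phi>)
  from FNot.IH[of n e e'] FNot.prems show ?case by simp
next
  case (FAnd \<phi> \<psi>)
  from FAnd.IH[of n e e'] FAnd.prems show ?case by simp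
qed simp_all

lemma vars_below_mono: "vars_below n \<phi> \<Longrightarrow> n \<le> m \<Longrightarrow> vars_below m \<phi>"
proof (induction \<phi> arbitrary: n m)
  case (FEx \<phi>)
  then show ?case using FEx.IH[of "Suc n" "Suc m"] by simp
qed fastforce+

lemma sat_pure: "pure_fm \<phi> \<Longrightarrow> sat K P e \<phi> \<longleftrightarrow> holds K e \<phi>"
  unfolding holds_def by (induction \<phi> arbitrary: e) auto

lemma holds_simps [simp]:
  "holds K e (FEq i j) \<longleftrightarrow> e ! i = e ! j"
  "holds K e (FEdge i j) \<longleftrightarrow> adj K (e ! i) (e ! j)"
  "holds K e (FNot \<phi>) \<longleftrightarrow> \<not> holds K e \<phi>"
  "holds K e (FAnd \<phi> \<psi>) \<longleftrightarrow> holds K e \<phi> \<and> holds K e \<psi>"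
  "holds K e (FEx \<phi>) \<longleftrightarrow> (\<exists>a\<in>verts K. holds K (a # e) \<phi>)"
  by (simp_all add: holds_def)

lemma holds_ren:
  assumes "vars_below n \<phi>" and "\<And>i. i < n \<Longrightarrow> e ! i = e' ! f i"
  shows "holds K e' (ren f \<phi>) \<longleftrightarrow> holds K e \<phi>"
  unfolding holds_def by (rule sat_ren[OF assms])

lemma holds_coincidence:
  assumes "vars_below n \<phi>" and "\<And>i. i < n \<Longrightarrow> e ! i = e' ! i"
  shows "holds K e' \<phi> \<longleftrightarrow> holds K e \<phi>"
  unfolding holds_def by (rule sat_coincidence[OF assms])

definition exs :: "nat \<Rightarrow> fm \<Rightarrow> fm" where
  "exs n \<phi> = (FEx ^^ n) \<phi>"

lemma holds_exs:
  "holds K a (exs n \<phi>) \<longleftrightarrow> (\<exists>e. length e = n \<and> set e \<subseteq> verts K \<and> holds K (e @ a) \<phi>)"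
proof (induction n arbitrary: a)
  case (Suc n)
  have "holds K a (exs (Suc n) \<phi>) \<longleftrightarrow> (\<exists>x\<in>verts K. holds K (x # a) (exs n \<phi>))"
    by (simp add: exs_def)
  also have "\<dots> \<longleftrightarrow> (\<exists>x\<in>verts K. \<exists>e. length e = n \<and> set e \<subseteq> verts K \<and> holds K ((e @ [x]) @ a) \<phi>)"
    by (simp add: Suc.IH)
  also have "\<dots> \<longleftrightarrow> (\<exists>e. length e = Suc n \<and> set e \<subseteq> verts K \<and> holds K (e @ a) \<phi>)" (is "?L \<longleftrightarrow> ?R")
  proof
    assume ?L
    then obtain x e where "x \<in> verts K" "length e = n" "set e \<subseteq> verts K" "holds K ((e @ [x]) @ a) \<phi>"
      by blast
    then show ?R by (intro exI[of _ "e @ [x]"]) auto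
  next
    assume ?R
    then obtain e where e: "length e = Suc n" "set e \<subseteq> verts K" "holds K (e @ a) \<phi>" by blast
    then have "e = butlast e @ [last e]" by (cases e) auto
    then obtain e' x where "e = e' @ [x]" by blast
    with e show ?L by auto
  qed
  finally show ?case .
qed (simp add: exs_def)

lemma pure_exs [simp]: "pure_fm (exs n \<phi>) \<longleftrightarrow> pure_fm \<phi>"
  unfolding exs_def by (induction n) auto

lemma vars_below_exs: "vars_below m (exs n \<phi>) \<longleftrightarrow> vars_below (n + m) \<phi>"
  unfolding exs_def by (induction n arbitrary: m) auto


section \<open>Definable relations\<close>

text \<open>Closure properties of this predicate replace explicit formulas. Parameters follow the
  variables, so that a quantifier, which binds index 0, acts on the head of the list while the
  parameters keep their place at the end.\<close>

definition definable :: "'a graph \<Rightarrow> 'a set \<Rightarrow> nat \<Rightarrow> ('a list \<Rightarrow> bool) \<Rightarrow> bool" where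
  "definable K A n R \<longleftrightarrow> (\<exists>\<phi> a. pure_fm \<phi> \<and> vars_below (n + length a) \<phi> \<and> set a \<subseteq> A \<and>
     (\<forall>e. length e = n \<and> set e \<subseteq> verts K \<longrightarrow> (R e \<longleftrightarrow> holds K (e @ a) \<phi>)))"

lemma definableI:
  assumes "pure_fm \<phi>" "vars_below (n + length a) \<phi>" "set a \<subseteq> A"
    and "\<And>e. length e = n \<Longrightarrow> set e \<subseteq> verts K \<Longrightarrow> R e \<longleftrightarrow> holds K (e @ a) \<phi>"
  shows "definable K A n R"
  unfolding definable_def using assms by blast

lemma definableE:
  assumes "definable K A n R"
  obtains \<phi> a where "pure_fm \<phi>" "vars_below (n + length a) \<phi>" "set a \<subseteq> A"
    "\<And>e. length e = n \<Longrightarrow> set e \<subseteq> verts K \<Longrightarrow> R e \<longleftrightarrow> holds K (e @ a) \<phi>"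
  using assms unfolding definable_def by blast

lemma definable_cong:
  assumes "definable K A n R" "\<And>e. length e = n \<Longrightarrow> set e \<subseteq> verts K \<Longrightarrow> Q e \<longleftrightarrow> R e"
  shows "definable K A n Q"
  using assms unfolding definable_def by metis

lemma definable_eq: "i < n \<Longrightarrow> j < n \<Longrightarrow> definable K A n (\<lambda>e. e ! i = e ! j)"
  by (rule definableI[of "FEq i j" n "[]"]) auto

lemma definable_adj: "i < n \<Longrightarrow> j < n \<Longrightarrow> definable K A n (\<lambda>e. adj K (e ! i) (e ! j))"
  by (rule definableI[of "FEdge i j" n "[]"]) auto

lemma definable_not: "definable K A n R \<Longrightarrow> definable K A n (\<lambda>e. \<not> R e)"
  by (erule definableE, rule definableI[of "FNot _" n]) auto

lemma definable_and:
  assumes "definable K A n R" "definable K A n Q"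
  shows "definable K A n (\<lambda>e. R e \<and> Q e)"
proof -
  obtain \<phi> a where p: "pure_fm \<phi>" "vars_below (n + length a) \<phi>" "set a \<subseteq> A"
    "\<And>e. length e = n \<Longrightarrow> set e \<subseteq> verts K \<Longrightarrow> R e \<longleftrightarrow> holds K (e @ a) \<phi>"
    by (rule definableE[OF assms(1)], rule that)
  obtain \<psi> b where q: "pure_fm \<psi>" "vars_below (n + length b) \<psi>" "set b \<subseteq> A"
    "\<And>e. length e = n \<Longrightarrow> set e \<subseteq> verts K \<Longrightarrow> Q e \<longleftrightarrow> holds K (e @ b) \<psi>"
    by (rule definableE[OF assms(2)], rule that)
  let ?f = "\<lambda>i. if i < n then i else i + length a"
  have 1: "holds K (e @ a @ b) \<phi> \<longleftrightarrow> holds K (e @ a) \<phi>" if "length e = n" for e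
    using that by (intro holds_coincidence[OF p(2)]) (auto simp: nth_append)
  have 2: "holds K (e @ a @ b) (ren ?f \<psi>) \<longleftrightarrow> holds K (e @ b) \<psi>" if "length e = n" for e
    using that by (intro holds_ren[OF q(2)]) (auto simp: nth_append)
  have 3: "vars_below (n + length (a @ b)) (ren ?f \<psi>)"
    by (rule vars_below_ren[OF q(2)]) auto
  show ?thesis
    by (rule definableI[of "FAnd \<phi> (ren ?f \<psi>)" n "a @ b"])
      (use p q 1 2 3 in \<open>auto intro: vars_below_mono\<close>)
qed

lemma definable_or:
  "definable K A n R \<Longrightarrow> definable K A n Q \<Longrightarrow> definable K A n (\<lambda>e. R e \<or> Q e)"
  by (rule definable_cong[OF definable_not[OF definable_and[OF definable_not definable_not]]]) auto

lemma definable_iff: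
  assumes "definable K A n R" "definable K A n Q"
  shows "definable K A n (\<lambda>e. R e \<longleftrightarrow> Q e)"
  by (rule definable_cong[OF definable_or[OF definable_and[OF assms]
          definable_and[OF definable_not[OF assms(1)] definable_not[OF assms(2)]]]]) auto

lemma definable_ex:
  assumes "definable K A (Suc n) R"
  shows "definable K A n (\<lambda>e. \<exists>x\<in>verts K. R (x # e))"
  by (rule definableE[OF assms], rule definableI[of "FEx _" n]) auto

lemma definable_const: "definable K A n (\<lambda>_. c)"
proof -
  have "definable K A n (\<lambda>e. \<not> (\<exists>x\<in>verts K. (x # e) ! 0 = (x # e) ! 0))"
    by (intro definable_not definable_ex definable_eq) auto
  \<comment> \<open>The vertex set may be empty, so the existence of a vertex cannot serve as truth;
    conjoining it with its negation gives falsity in every case.\<close>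
  then have F: "definable K A n (\<lambda>e. \<not> (\<exists>x\<in>verts K. (x # e) ! 0 = (x # e) ! 0) \<and>
      \<not> \<not> (\<exists>x\<in>verts K. (x # e) ! 0 = (x # e) ! 0))"
    by (intro definable_and definable_not definable_ex definable_eq) auto
  show ?thesis
  proof (cases c)
    case True
    show ?thesis by (rule definable_cong[OF definable_not[OF F]]) (use True in auto)
  next
    case False
    show ?thesis by (rule definable_cong[OF F]) (use False in auto)
  qed
qed

lemma definable_map:
  assumes "definable K A m R" "length is = m" "\<And>i. i \<in> set is \<Longrightarrow> i < n"
  shows "definable K A n (\<lambda>e. R (map ((!) e) is))"
proof -
  obtain \<phi> a where p: "pure_fm \<phi>" "vars_below (m + length a) \<phi>" "set a \<subseteq> A"
    "\<And>e. length e = m \<Longrightarrow> set e \<subseteq> verts K \<Longrightarrow> R e \<longleftrightarrow> holds K (e @ a) \<phi>"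
    by (rule definableE[OF assms(1)], rule that)
  let ?f = "\<lambda>i. if i < m then is ! i else i - m + n"
  have v: "vars_below (n + length a) (ren ?f \<phi>)"
    by (rule vars_below_ren[OF p(2)]) (use assms in \<open>auto simp: less_diff_conv2 intro!: trans_less_add1\<close>)
  have h: "holds K (e @ a) (ren ?f \<phi>) \<longleftrightarrow> holds K (map ((!) e) is @ a) \<phi>" if "length e = n" for e
    by (rule holds_ren[OF p(2)]) (use assms that in \<open>auto simp: nth_append\<close>)
  show ?thesis
  proof (rule definableI[OF _ v])
    fix e :: "'a list"
    assume e: "length e = n" "set e \<subseteq> verts K"
    have "set (map ((!) e) is) \<subseteq> verts K"
      using e assms(3) by (auto intro!: subsetD[OF e(2)])
    then show "R (map ((!) e) is) \<longleftrightarrow> holds K (e @ a) (ren ?f \<phi>)"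
      using p(4)[of "map ((!) e) is"] h[OF e(1)] assms(2) by simp
  qed (use p in auto)
qed

lemma definable_params:
  assumes "definable K A (n + length b) R" "set b \<subseteq> A" "A \<subseteq> verts K"
  shows "definable K A n (\<lambda>e. R (e @ b))"
proof -
  obtain \<phi> a where p: "pure_fm \<phi>" "vars_below (n + length b + length a) \<phi>" "set a \<subseteq> A"
    "\<And>e. length e = n + length b \<Longrightarrow> set e \<subseteq> verts K \<Longrightarrow> R e \<longleftrightarrow> holds K (e @ a) \<phi>"
    by (rule definableE[OF assms(1)], rule that)
  show ?thesis
    by (rule definableI[of \<phi> n "b @ a"]) (use p assms in \<open>auto simp: add.assoc\<close>)
qed

lemma definable_bin:
  assumes "definable K A 2 (\<lambda>e. B (e ! 0) (e ! 1))" "i < n" "j < n"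
  shows "definable K A n (\<lambda>e. B (e ! i) (e ! j))"
  using definable_map[OF assms(1), of "[i, j]" n] assms(2,3) by auto

lemma definable_bin_param:
  assumes "definable K A 2 (\<lambda>e. B (e ! 0) (e ! 1))" "i < n" "s \<in> A" "A \<subseteq> verts K"
  shows "definable K A n (\<lambda>e. B (e ! i) s)"
proof -
  have "definable K A (n + length [s]) (\<lambda>e. B (e ! i) (e ! n))"
    by (rule definable_bin[OF assms(1)]) (use assms(2) in auto)
  from definable_params[OF this _ assms(4)] have "definable K A n (\<lambda>e. B ((e @ [s]) ! i) ((e @ [s]) ! n))"
    using assms(3) by simp
  then show ?thesis
    by (rule definable_cong) (use assms(2) in \<open>auto simp: nth_append\<close>)
qed

lemma definable_eq_param:
  "i < n \<Longrightarrow> s \<in> A \<Longrightarrow> A \<subseteq> verts K \<Longrightarrow> definable K A n (\<lambda>e. e ! i = s)"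
  by (rule definable_bin_param[of _ _ "(=)"]) (auto intro: definable_eq)

lemma definable_adj_param:
  "i < n \<Longrightarrow> s \<in> A \<Longrightarrow> A \<subseteq> verts K \<Longrightarrow> definable K A n (\<lambda>e. adj K (e ! i) s)"
  by (rule definable_bin_param[of _ _ "adj K"]) (auto intro: definable_adj)

lemma definable_ball:
  assumes "finite I" "\<And>k. k \<in> I \<Longrightarrow> definable K A n (R k)"
  shows "definable K A n (\<lambda>e. \<forall>k\<in>I. R k e)"
  using assms by (induction I rule: finite_induct) (auto intro: definable_const definable_and)

lemma definable_bex:
  assumes "finite I" "\<And>k. k \<in> I \<Longrightarrow> definable K A n (R k)"
  shows "definable K A n (\<lambda>e. \<exists>k\<in>I. R k e)"
  using assms by (induction I rule: finite_induct) (auto intro: definable_const definable_or)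

section \<open>Transfer to the substructure and exclusion of orders\<close>

text \<open>That some tuple satisfies \<open>R\<close> is a sentence with parameters in
  \<open>G\<close>. It passes down to \<open>G\<close>, and the tuple found there satisfies the
  defining formula in \<open>H\<close> again.\<close>

lemma elementary_reflect:
  assumes "elementary_substructure G H" "definable H (verts G) n R"
    and "length e = n" "set e \<subseteq> verts H" "R e"
  obtains e' where "length e' = n" "set e' \<subseteq> verts G" "R e'"
proof -
  have GH: "verts G \<subseteq> verts H" using assms(1) by (simp add: elementary_substructure_def)
  obtain \<phi> a where p: "pure_fm \<phi>" "vars_below (n + length a) \<phi>" "set a \<subseteq> verts G"
    "\<And>e. length e = n \<Longrightarrow> set e \<subseteq> verts H \<Longrightarrow> R e \<longleftrightarrow> holds H (e @ a) \<phi>"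
    by (rule definableE[OF assms(2)], rule that)
  have el: "holds G b \<psi> \<longleftrightarrow> holds H b \<psi>"
    if "pure_fm \<psi>" "vars_below (length b) \<psi>" "set b \<subseteq> verts G" for \<psi> b
    using assms(1) that by (auto simp: elementary_substructure_def)
  have "holds H a (exs n \<phi>)" using p(4)[of e] assms(3-5) by (auto simp: holds_exs)
  then have "holds G a (exs n \<phi>)" using el[of "exs n \<phi>" a] p by (simp add: vars_below_exs)
  then obtain e' where e': "length e' = n" "set e' \<subseteq> verts G" "holds G (e' @ a) \<phi>"
    by (auto simp: holds_exs)
  then have "holds H (e' @ a) \<phi>" using el[of \<phi> "e' @ a"] p by simp
  then have "R e'" using p(4)[of e'] e' GH by auto
  with e' that show thesis by blast
qed

text \<open>With \<open>X\<close> as a unary predicate the relation becomes one formula of the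
  expanded language, so monadic stability bounds its orders. The bound \<open>n\<close> comes from
  the formula and is fixed before \<open>X\<close>, \<open>x\<close> and \<open>y\<close> are
  chosen.\<close>

lemma no_order_marked:
  assumes "monadically_stable K" and "definable K (verts K) (Suc (p + q)) R"
  obtains n :: nat where "\<And>X x y. X \<subseteq> verts K \<Longrightarrow>
    (\<And>i. length (x i) = p \<and> set (x i) \<subseteq> verts K) \<Longrightarrow>
    (\<And>i. length (y i) = q \<and> set (y i) \<subseteq> verts K) \<Longrightarrow>
    (\<And>i j. i < n \<Longrightarrow> j < n \<Longrightarrow> (\<exists>z\<in>X. R (z # x i @ y j)) \<longleftrightarrow> i \<le> j) \<Longrightarrow> False"
proof -
  obtain \<phi> a where f: "pure_fm \<phi>" "vars_below (Suc (p + q) + length a) \<phi>" "set a \<subseteq> verts K"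
    "\<And>e. length e = Suc (p + q) \<Longrightarrow> set e \<subseteq> verts K \<Longrightarrow> R e \<longleftrightarrow> holds K (e @ a) \<phi>"
    by (rule definableE[OF assms(2)], rule that)
  \<comment> \<open>Monadic stability speaks of tuples of one common length, so \<open>x\<close>,
    \<open>y\<close> and the parameters are packed together. The formula reads \<open>x\<close> from
    the first tuple and the rest from the second, where indices are larger by
    \<open>m\<close>.\<close>
  define m where "m = p + q + length a"
  define g where "g = (\<lambda>i. if i \<le> p then i else i + m)"
  define \<psi> where "\<psi> = FEx (FAnd (FPred 0 0) (ren g \<phi>))"
  have "vars_below (Suc (2 * m)) (ren g \<phi>)"
    by (rule vars_below_ren[OF f(2)]) (auto simp: g_def m_def)
  then have vb: "vars_below (2 * m) \<psi>" by (simp add: \<psi>_def)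
  have main: "sat K (\<lambda>_. X) ((x @ y' @ a) @ (x' @ y @ a)) \<psi> \<longleftrightarrow> (\<exists>z\<in>X. R (z # x @ y))"
    if "X \<subseteq> verts K" "length x = p" "length x' = p" "length y = q" "length y' = q"
      "set x \<subseteq> verts K" "set y \<subseteq> verts K" for X x y x' y'
  proof -
    have "sat K (\<lambda>_. X) (z # (x @ y' @ a) @ (x' @ y @ a)) (ren g \<phi>) \<longleftrightarrow> R (z # x @ y)"
      if z: "z \<in> verts K" for z
    proof -
      have "((z # x @ y) @ a) ! i = (z # (x @ y' @ a) @ (x' @ y @ a)) ! g i"
        if "i < Suc (p + q) + length a" for i
      proof (cases i)
        case (Suc k)
        then show ?thesis
          using \<open>length x = p\<close> \<open>length x' = p\<close> \<open>length y = q\<close> \<open>length y' = q\<close>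
          by (simp add: g_def m_def nth_append)
      qed (simp add: g_def)
      from holds_ren[OF f(2) this]
      have "holds K (z # (x @ y' @ a) @ (x' @ y @ a)) (ren g \<phi>) \<longleftrightarrow> holds K ((z # x @ y) @ a) \<phi>"
        by blast
      moreover have "R (z # x @ y) \<longleftrightarrow> holds K ((z # x @ y) @ a) \<phi>"
        using z \<open>length x = p\<close> \<open>length y = q\<close> \<open>set x \<subseteq> verts K\<close> \<open>set y \<subseteq> verts K\<close>
        by (intro f(4)) auto
      ultimately show ?thesis using f(1) by (simp add: sat_pure)
    qed
    then have "(\<exists>z\<in>verts K. z \<in> X \<and> sat K (\<lambda>_. X) (z # (x @ y' @ a) @ (x' @ y @ a)) (ren g \<phi>))
        \<longleftrightarrow> (\<exists>z\<in>X. R (z # x @ y))"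
      using \<open>X \<subseteq> verts K\<close> by blast
    then show ?thesis unfolding \<psi>_def by simp
  qed
  obtain n :: nat where n: "\<not> (\<exists>P v. (\<forall>k. P k \<subseteq> verts K) \<and>
             (\<forall>i<n. length (v i) = m \<and> set (v i) \<subseteq> verts K) \<and>
             (\<forall>i<n. \<forall>j<n. sat K P (v i @ v j) \<psi> \<longleftrightarrow> i \<le> j))"
    using assms(1)[unfolded monadically_stable_def monadically_stable_class_def not_ex,
        THEN spec[of _ \<psi>], THEN spec[of _ m]] vb by auto
  show thesis
  proof (rule that[of n])
    fix X x y
    assume X: "X \<subseteq> verts K" and x: "\<And>i. length (x i) = p \<and> set (x i) \<subseteq> verts K"
      and y: "\<And>i. length (y i) = q \<and> set (y i) \<subseteq> verts K"
      and o: "\<And>i j. i < n \<Longrightarrow> j < n \<Longrightarrow> (\<exists>z\<in>X. R (z # x i @ y j)) \<longleftrightarrow> i \<le> j"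
    have 1: "\<forall>i<n. length (x i @ y i @ a) = m \<and> set (x i @ y i @ a) \<subseteq> verts K"
      using x y f(3) by (simp add: m_def)
    have 2: "\<forall>i<n. \<forall>j<n. sat K (\<lambda>_. X) ((x i @ y i @ a) @ (x j @ y j @ a)) \<psi> \<longleftrightarrow> i \<le> j"
    proof (intro allI impI)
      fix i j assume ij: "i < n" "j < n"
      have "sat K (\<lambda>_. X) ((x i @ y i @ a) @ (x j @ y j @ a)) \<psi> \<longleftrightarrow> (\<exists>z\<in>X. R (z # x i @ y j))"
        by (rule main[OF X]) (use x y in auto)
      then show "sat K (\<lambda>_. X) ((x i @ y i @ a) @ (x j @ y j @ a)) \<psi> \<longleftrightarrow> i \<le> j"
        using o[OF ij] by (rule trans)
    qed
    show False
    proof (rule notE[OF n], intro exI[of _ "\<lambda>_. X"] exI[of _ "\<lambda>i. x i @ y i @ a"] conjI)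
      show "\<forall>k::nat. X \<subseteq> verts K" using X by blast
    qed (fact 1, fact 2)
  qed
qed

lemma no_order:
  fixes x y :: "nat \<Rightarrow> 'a list"
  assumes "monadically_stable K" and "definable K (verts K) (p + q) R"
    and x: "\<And>i. length (x i) = p \<and> set (x i) \<subseteq> verts K"
    and y: "\<And>i. length (y i) = q \<and> set (y i) \<subseteq> verts K"
    and ord: "\<And>i j. R (x i @ y j) \<longleftrightarrow> i \<le> j"
    and z: "z \<in> verts K"
  shows False
proof -
  \<comment> \<open>A dummy first variable, ranging over the marked singleton \<open>{z}\<close>,
    brings \<open>R\<close> into the form of \<open>no_order_marked\<close>.\<close>
  have "definable K (verts K) (Suc (p + q)) (\<lambda>e. R (map ((!) e) (map Suc [0..<p + q])))"
    using assms(2) by (rule definable_map) auto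
  then have "definable K (verts K) (Suc (p + q)) (\<lambda>e. R (tl e))"
  proof (rule definable_cong)
    fix e :: "'a list" assume "length e = Suc (p + q)" "set e \<subseteq> verts K"
    then have "map ((!) e) (map Suc [0..<p + q]) = tl e"
      by (intro nth_equalityI) (auto simp: nth_tl)
    then show "R (tl e) \<longleftrightarrow> R (map ((!) e) (map Suc [0..<p + q]))" by simp
  qed
  then show False
  proof (rule no_order_marked[OF assms(1)])
    fix n :: nat
    assume n: "\<And>X (x :: nat \<Rightarrow> 'a list) (y :: nat \<Rightarrow> 'a list). X \<subseteq> verts K \<Longrightarrow>
      (\<And>i. length (x i) = p \<and> set (x i) \<subseteq> verts K) \<Longrightarrow>
      (\<And>i. length (y i) = q \<and> set (y i) \<subseteq> verts K) \<Longrightarrow>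
      (\<And>i j. i < n \<Longrightarrow> j < n \<Longrightarrow> (\<exists>z\<in>X. R (tl (z # x i @ y j))) \<longleftrightarrow> i \<le> j) \<Longrightarrow> False"
    show False
      by (rule n[of "{z}" x y]) (use x y ord z in auto)
  qed
qed


section \<open>Distances and flips\<close>

definition near :: "'a graph \<Rightarrow> nat \<Rightarrow> 'a \<Rightarrow> 'a \<Rightarrow> bool" where
  "near K r x y \<longleftrightarrow> (\<exists>n\<le>r. (adj K ^^ n) x y)"

lemma near_0 [simp]: "near K 0 x y \<longleftrightarrow> x = y"
  by (auto simp: near_def)

lemma near_Suc: "near K (Suc r) x y \<longleftrightarrow> near K r x y \<or> (\<exists>z. near K r x z \<and> adj K z y)"
proof
  assume "near K (Suc r) x y"
  then obtain n where n: "n \<le> Suc r" "(adj K ^^ n) x y" by (auto simp: near_def)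
  show "near K r x y \<or> (\<exists>z. near K r x z \<and> adj K z y)"
  proof (cases "n \<le> r")
    case False
    with n have "(adj K ^^ Suc r) x y" by (simp add: le_Suc_eq)
    then show ?thesis by (auto simp: near_def)
  qed (use n in \<open>auto simp: near_def\<close>)
next
  assume "near K r x y \<or> (\<exists>z. near K r x z \<and> adj K z y)"
  then show "near K (Suc r) x y"
  proof
    assume "\<exists>z. near K r x z \<and> adj K z y"
    then obtain z n where "n \<le> r" "(adj K ^^ n) x z" "adj K z y" by (auto simp: near_def)
    then have "Suc n \<le> Suc r" "(adj K ^^ Suc n) x y" by auto
    then show ?thesis unfolding near_def by blast
  qed (auto simp: near_def intro: le_SucI)
qed

lemma near_refl [simp]: "near K r x x"
  by (induction r) (auto simp: near_Suc)

lemma near_mono: "near K r x y \<Longrightarrow> r \<le> s \<Longrightarrow> near K s x y"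
  unfolding near_def using le_trans by blast

lemma near_adj: "adj K x y \<Longrightarrow> near K (Suc 0) x y"
  by (auto simp: near_Suc)

lemma near_trans: "near K r x y \<Longrightarrow> near K s y z \<Longrightarrow> near K (r + s) x z"
  by (induction s arbitrary: z) (auto simp: near_Suc)

text \<open>A path uses only edges that leave its earlier vertices, and its last vertex need not lie
  in the ball of radius \<open>r\<close>; this is why \<open>s\<close> may reach
  \<open>Suc r\<close>.\<close>

lemma near_agree:
  assumes "\<And>w x. near K r c w \<Longrightarrow> adj K' w x \<longleftrightarrow> adj K w x" "s \<le> Suc r"
  shows "near K' s c x \<longleftrightarrow> near K s c x"
  using assms(2)
proof (induction s arbitrary: x)
  case (Suc s)
  have "adj K' z x \<longleftrightarrow> adj K z x" if "near K s c z" for z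
    using assms(1) near_mono[OF that, of r] Suc.prems by auto
  then show ?case using Suc by (auto simp: near_Suc)
qed simp

lemma near_sym:
  assumes "is_graph K" "near K r x y"
  shows "near K r y x"
  using assms(2)
proof (induction r arbitrary: y)
  case (Suc r)
  consider "near K r x y" | z where "near K r x z" "adj K z y"
    using Suc.prems near_Suc[of K r x y] by blast
  then show ?case
  proof cases
    case 1
    then show ?thesis using Suc.IH by (simp add: near_Suc)
  next
    case 2
    then have "near K 1 y z" "near K r z x"
      using assms(1) Suc.IH by (auto simp: is_graph_def intro: near_adj)
    then show ?thesis using near_trans[of K 1 y z r x] by simp
  qed
qed simp

lemma gdist_gt_iff: "gdist K u v > enat r \<longleftrightarrow> \<not> near K r u v"
proof
  assume "gdist K u v > enat r"
  show "\<not> near K r u v"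
  proof
    assume "near K r u v"
    then obtain n where "n \<le> r" "(adj K ^^ n) u v" by (auto simp: near_def)
    then have "gdist K u v \<le> enat n" by (auto simp: gdist_def intro: INF_lower)
    also have "\<dots> \<le> enat r" using \<open>n \<le> r\<close> by simp
    finally show False using \<open>gdist K u v > enat r\<close> by simp
  qed
next
  assume *: "\<not> near K r u v"
  have "enat (Suc r) \<le> gdist K u v"
    unfolding gdist_def
  proof (rule INF_greatest)
    fix n assume "n \<in> {n. (adj K ^^ n) u v}"
    with * have "\<not> n \<le> r" by (auto simp: near_def)
    then show "enat (Suc r) \<le> enat n" by simp
  qed
  then show "gdist K u v > enat r" by (meson Suc_ile_eq)
qed

section \<open>Atomic types, and flips as conditions on types\<close>

text \<open>Encoding a type as a pair of subsets of \<open>S\<close> turns classes into values: a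
  finite \<open>S\<close> has finitely many, and having the same type is an equation.\<close>

definition atype :: "'a graph \<Rightarrow> 'a set \<Rightarrow> 'a \<Rightarrow> 'a set \<times> 'a set" where
  "atype H S w = ({s \<in> S. w = s}, {s \<in> S. adj H w s})"

lemma atype_eq_iff:
  "atype H S w = atype H S w' \<longleftrightarrow> (\<forall>s\<in>S. (w = s \<longleftrightarrow> w' = s) \<and> (adj H w s \<longleftrightarrow> adj H w' s))"
  unfolding atype_def by auto

lemma atype_antimono: "atype H T w = atype H T w' \<Longrightarrow> S \<subseteq> T \<Longrightarrow> atype H S w = atype H S w'"
  unfolding atype_eq_iff by blast

text \<open>This is \<open>definable_flip\<close> without quotients: two pairs with the same types
  are both flipped or both kept.\<close>

definition coherent_flip :: "'a graph \<Rightarrow> 'a set \<Rightarrow> 'a graph \<Rightarrow> bool" where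
  "coherent_flip H S H' \<longleftrightarrow> is_graph H' \<and> verts H' = verts H \<and>
     (\<forall>a\<in>verts H. \<forall>b\<in>verts H. \<forall>a'\<in>verts H. \<forall>b'\<in>verts H.
        atype H S a = atype H S a' \<longrightarrow> atype H S b = atype H S b' \<longrightarrow> a \<noteq> b \<longrightarrow> a' \<noteq> b' \<longrightarrow>
        ((adj H a b \<longleftrightarrow> adj H' a b) \<longleftrightarrow> (adj H a' b' \<longleftrightarrow> adj H' a' b')))"

lemma coherent_flipD:
  assumes "coherent_flip H S H'" "a \<in> verts H" "b \<in> verts H" "a' \<in> verts H" "b' \<in> verts H"
    "atype H S a = atype H S a'" "atype H S b = atype H S b'" "a \<noteq> b" "a' \<noteq> b'"
  shows "(adj H a b \<longleftrightarrow> adj H' a b) \<longleftrightarrow> (adj H a' b' \<longleftrightarrow> adj H' a' b')"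
  using assms unfolding coherent_flip_def by blast

lemma atype_class:
  "a \<in> verts H \<Longrightarrow> same_atomic_type H S `` {a} = {b \<in> verts H. atype H S a = atype H S b}"
  unfolding same_atomic_type_def atype_eq_iff by auto

lemma definable_flip_iff: "definable_flip H S H' \<longleftrightarrow> coherent_flip H S H'"
proof
  assume *: "definable_flip H S H'"
  show "coherent_flip H S H'"
    unfolding coherent_flip_def
  proof (intro conjI ballI impI)
    fix a b a' b'
    assume v: "a \<in> verts H" "b \<in> verts H" "a' \<in> verts H" "b' \<in> verts H"
      and t: "atype H S a = atype H S a'" "atype H S b = atype H S b'" and ne: "a \<noteq> b" "a' \<noteq> b'"
    let ?A = "same_atomic_type H S `` {a}" and ?B = "same_atomic_type H S `` {b}"
    have q: "?A \<in> verts H // same_atomic_type H S" "?B \<in> verts H // same_atomic_type H S"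
      using v by (auto intro: quotientI)
    have "\<forall>A \<in> verts H // same_atomic_type H S. \<forall>B \<in> verts H // same_atomic_type H S.
        (\<forall>a\<in>A. \<forall>b\<in>B. a \<noteq> b \<longrightarrow> (adj H a b \<longleftrightarrow> adj H' a b)) \<or>
        (\<forall>a\<in>A. \<forall>b\<in>B. a \<noteq> b \<longrightarrow> (adj H a b \<longleftrightarrow> \<not> adj H' a b))"
      using * unfolding definable_flip_def by (elim conjE)
    from bspec[OF bspec[OF this q(1)] q(2)]
    have "(\<forall>a\<in>?A. \<forall>b\<in>?B. a \<noteq> b \<longrightarrow> (adj H a b \<longleftrightarrow> adj H' a b)) \<or>
        (\<forall>a\<in>?A. \<forall>b\<in>?B. a \<noteq> b \<longrightarrow> (adj H a b \<longleftrightarrow> \<not> adj H' a b))" .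
    moreover have "a \<in> ?A" "a' \<in> ?A" "b \<in> ?B" "b' \<in> ?B" using v t by (auto simp: atype_class)
    ultimately show "(adj H a b \<longleftrightarrow> adj H' a b) \<longleftrightarrow> (adj H a' b' \<longleftrightarrow> adj H' a' b')"
      using ne by blast
  qed (use * in \<open>auto simp: definable_flip_def\<close>)
next
  assume *: "coherent_flip H S H'"
  show "definable_flip H S H'"
    unfolding definable_flip_def
  proof (intro conjI ballI)
    fix A B assume "A \<in> verts H // same_atomic_type H S" "B \<in> verts H // same_atomic_type H S"
    then obtain a0 b0 where v: "a0 \<in> verts H" "b0 \<in> verts H"
      and A: "A = {b \<in> verts H. atype H S a0 = atype H S b}"
      and B: "B = {b \<in> verts H. atype H S b0 = atype H S b}"
      by (auto elim!: quotientE simp: atype_class)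
    show "(\<forall>a\<in>A. \<forall>b\<in>B. a \<noteq> b \<longrightarrow> (adj H a b \<longleftrightarrow> adj H' a b)) \<or>
        (\<forall>a\<in>A. \<forall>b\<in>B. a \<noteq> b \<longrightarrow> (adj H a b \<longleftrightarrow> \<not> adj H' a b))"
    proof (cases "\<exists>a\<in>A. \<exists>b\<in>B. a \<noteq> b \<and> (adj H a b \<longleftrightarrow> adj H' a b)")
      case True
      then obtain a b where ab: "a \<in> A" "b \<in> B" "a \<noteq> b" "adj H a b \<longleftrightarrow> adj H' a b" by blast
      have "adj H a' b' \<longleftrightarrow> adj H' a' b'" if "a' \<in> A" "b' \<in> B" "a' \<noteq> b'" for a' b'
        using coherent_flipD[OF *, of a b a' b'] ab that by (auto simp: A B)
      then show ?thesis by blast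
    qed blast
  qed (use * in \<open>auto simp: coherent_flip_def\<close>)
qed

lemma definable_atype:
  assumes "finite S" "S \<subseteq> A" "A \<subseteq> verts K" "i < n"
  shows "definable K A n (\<lambda>e. atype K S (e ! i) = \<kappa>)"
proof -
  \<comment> \<open>The last conjunct handles a \<open>\<kappa>\<close> with elements outside
    \<open>S\<close>, which is the type of no vertex and which the first two conjuncts would not
    detect.\<close>
  have "definable K A n (\<lambda>e. (\<forall>s\<in>S. e ! i = s \<longleftrightarrow> s \<in> fst \<kappa>) \<and>
      (\<forall>s\<in>S. adj K (e ! i) s \<longleftrightarrow> s \<in> snd \<kappa>) \<and> \<kappa> \<in> Pow S \<times> Pow S)"
    using assms by (intro definable_and definable_ball definable_iff definable_const
        definable_eq_param definable_adj_param) auto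
  then show ?thesis
    by (rule definable_cong) (auto simp: atype_def prod_eq_iff mem_Times_iff)
qed

lemma definable_flip_adj:
  assumes fl: "coherent_flip H S H'" and S: "finite S" "S \<subseteq> A" "A \<subseteq> verts H"
  shows "definable H A 2 (\<lambda>e. adj H' (e ! 0) (e ! 1))"
proof -
  \<comment> \<open>\<open>D\<close> collects the pairs of types between which adjacency is
    reversed; adjacency in \<open>H'\<close> is that of \<open>H\<close> corrected along this finite
    set.\<close>
  define D where "D = {(atype H S a, atype H S b) |a b. a \<in> verts H \<and> b \<in> verts H \<and> a \<noteq> b \<and>
     (adj H a b \<longleftrightarrow> \<not> adj H' a b)}"
  have "D \<subseteq> (Pow S \<times> Pow S) \<times> (Pow S \<times> Pow S)"
    unfolding D_def atype_def by auto
  then have fin: "finite D" by (rule finite_subset) (simp add: S(1))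
  have "definable H A 2 (\<lambda>e. \<not> e ! 0 = e ! 1 \<and> \<not> (adj H (e ! 0) (e ! 1) \<longleftrightarrow>
     (\<exists>\<kappa>\<in>D. atype H S (e ! 0) = fst \<kappa> \<and> atype H S (e ! 1) = snd \<kappa>)))"
    using S fin by (intro definable_and definable_not definable_iff definable_bex definable_atype
        definable_eq definable_adj) auto
  then show ?thesis
  proof (rule definable_cong)
    fix e :: "'a list" assume e: "length e = 2" "set e \<subseteq> verts H"
    define x y where "x = e ! 0" and "y = e ! 1"
    have xy: "x \<in> verts H" "y \<in> verts H" using e by (auto simp: x_def y_def intro!: subsetD[OF e(2)])
    have "(\<exists>\<kappa>\<in>D. atype H S x = fst \<kappa> \<and> atype H S y = snd \<kappa>) \<longleftrightarrow> (adj H x y \<longleftrightarrow> \<not> adj H' x y)"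
      if "x \<noteq> y"
    proof
      assume "\<exists>\<kappa>\<in>D. atype H S x = fst \<kappa> \<and> atype H S y = snd \<kappa>"
      then obtain \<kappa> where k: "\<kappa> \<in> D" "atype H S x = fst \<kappa>" "atype H S y = snd \<kappa>" by blast
      from k(1) obtain a b where "\<kappa> = (atype H S a, atype H S b)"
        and "a \<in> verts H" "b \<in> verts H" "a \<noteq> b" "adj H a b \<longleftrightarrow> \<not> adj H' a b"
        unfolding D_def by blast
      then show "adj H x y \<longleftrightarrow> \<not> adj H' x y" using coherent_flipD[OF fl xy, of a b] that k by auto
    next
      assume "adj H x y \<longleftrightarrow> \<not> adj H' x y"
      then have "(atype H S x, atype H S y) \<in> D" unfolding D_def using xy that by blast
      then show "\<exists>\<kappa>\<in>D. atype H S x = fst \<kappa> \<and> atype H S y = snd \<kappa>" by force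
    qed
    moreover have "\<not> adj H' x x" using fl by (auto simp: coherent_flip_def is_graph_def)
    ultimately show "adj H' (e ! 0) (e ! 1) \<longleftrightarrow> \<not> e ! 0 = e ! 1 \<and> \<not> (adj H (e ! 0) (e ! 1) \<longleftrightarrow>
     (\<exists>\<kappa>\<in>D. atype H S (e ! 0) = fst \<kappa> \<and> atype H S (e ! 1) = snd \<kappa>))"
      unfolding x_def[symmetric] y_def[symmetric] by blast
  qed
qed

lemma definable_near:
  assumes fl: "coherent_flip H S H'" and S: "finite S" "S \<subseteq> A" "A \<subseteq> verts H"
  shows "definable H A 2 (\<lambda>e. near H' r (e ! 0) (e ! 1))"
proof (induction r)
  case 0
  show ?case using definable_eq[of 0 2 1] by simp
next
  case (Suc r)
  have "definable H A 3 (\<lambda>e. near H' r (e ! 1) (e ! 0) \<and> adj H' (e ! 0) (e ! 2))"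
    by (intro definable_and definable_bin[OF Suc] definable_bin[OF definable_flip_adj[OF assms]]) auto
  then have "definable H A (Suc 2) (\<lambda>e. near H' r (e ! 1) (e ! 0) \<and> adj H' (e ! 0) (e ! 2))"
    by (simp add: numeral_3_eq_3 numeral_2_eq_2)
  from definable_or[OF Suc definable_ex[OF this]]
  show ?case
  proof (rule definable_cong)
    fix e :: "'a list"
    have "adj H' z y \<Longrightarrow> z \<in> verts H" for z y
      using fl by (auto simp: coherent_flip_def is_graph_def)
    then show "near H' (Suc r) (e ! 0) (e ! 1) \<longleftrightarrow> near H' r (e ! 0) (e ! 1) \<or>
      (\<exists>x\<in>verts H. near H' r ((x # e) ! 1) ((x # e) ! 0) \<and> adj H' ((x # e) ! 0) ((x # e) ! 2))"
      by (auto simp: near_Suc numeral_2_eq_2)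
  qed
qed


section \<open>Separation from an elementary substructure\<close>

text \<open>Two members of an infinite family differ at some \<open>a\<close>. One side of
  \<open>a\<close> contains infinitely many members and is kept; the other side contains one of the
  two and supplies the next \<open>A\<close>. Passing to a subsequence makes the side
  \<open>c\<close> constant.\<close>

lemma infinite_family_sequence:
  assumes "infinite F"
  obtains A :: "nat \<Rightarrow> 'b set" and a c where "\<And>n. A n \<in> F" "\<And>n. a n \<in> \<Union>F"
    "\<And>n. a n \<in> A n \<longleftrightarrow> c" "\<And>n m. n < m \<Longrightarrow> a n \<in> A m \<longleftrightarrow> \<not> c"
proof -
  \<comment> \<open>\<open>x\<close> is the current subfamily, \<open>z\<close> consists of the
    separating element, the side and the set split off, and \<open>y\<close> is the part on the
    other side.\<close>
  define Q where "Q x y z \<longleftrightarrow> snd (snd z) \<in> x \<and> fst z \<in> \<Union>F \<and> (fst z \<in> snd (snd z) \<longleftrightarrow> fst (snd z)) \<and>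
      y = {B \<in> x. fst z \<in> B \<longleftrightarrow> \<not> fst (snd z)}" for x y and z :: "'b \<times> bool \<times> 'b set"
  have "\<exists>f. \<forall>n::nat. (infinite (f n) \<and> f n \<subseteq> F) \<and> (\<exists>z. Q (f n) (f (Suc n)) z)"
  proof (rule dependent_nat_choice)
    show "\<exists>x. infinite x \<and> x \<subseteq> F" using assms by blast
  next
    fix x and n :: nat
    assume x: "infinite x \<and> x \<subseteq> F"
    then obtain B where B: "B \<in> x" by fastforce
    have "infinite (x - {B})" using x by simp
    then obtain C where C: "C \<in> x" "C \<noteq> B" by (metis DiffE ex_in_conv finite.emptyI insertI1)
    from C(2) obtain a where a: "a \<in> B \<and> a \<notin> C \<or> a \<in> C \<and> a \<notin> B" by blast
    have "x \<subseteq> {D \<in> x. a \<in> D \<longleftrightarrow> \<not> True} \<union> {D \<in> x. a \<in> D \<longleftrightarrow> \<not> False}" by blast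
    from infinite_super[OF this] x have "infinite {D \<in> x. a \<in> D \<longleftrightarrow> \<not> True} \<or> infinite {D \<in> x. a \<in> D \<longleftrightarrow> \<not> False}"
      unfolding infinite_Un by blast
    then obtain c where c: "infinite {D \<in> x. a \<in> D \<longleftrightarrow> \<not> c}" by blast
    obtain A where "A \<in> x" "a \<in> A \<longleftrightarrow> c" using a B C by blast
    moreover have "a \<in> \<Union>F" using a B C x by blast
    ultimately have "Q x {B \<in> x. a \<in> B \<longleftrightarrow> \<not> c} (a, c, A)" by (simp add: Q_def)
    moreover have "{B \<in> x. a \<in> B \<longleftrightarrow> \<not> c} \<subseteq> F" using x by blast
    ultimately show "\<exists>y. (infinite y \<and> y \<subseteq> F) \<and> (\<exists>z. Q x y z)"
      using c by blast
  qed
  then obtain f where f': "\<forall>n. (infinite (f n) \<and> f n \<subseteq> F) \<and> (\<exists>z. Q (f n) (f (Suc n)) z)" by blast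
  then have f: "\<And>n. f n \<subseteq> F" and "\<forall>n. \<exists>z. Q (f n) (f (Suc n)) z" by blast+
  from choice[OF this(2)] obtain z where z: "\<And>n. Q (f n) (f (Suc n)) (z n)" by blast
  define a c A where "a n = fst (z n)" and "c n = fst (snd (z n))" and "A n = snd (snd (z n))" for n
  have g: "\<And>n. A n \<in> f n" "\<And>n. a n \<in> \<Union>F" "\<And>n. (a n \<in> A n) = c n"
    "\<And>n. f (Suc n) = {B \<in> f n. (a n \<in> B) = (\<not> c n)}"
    using z unfolding Q_def a_def c_def A_def by blast+
  have dec: "f m \<subseteq> f n" if "n \<le> m" for n m
    by (rule lift_Suc_antimono_le[of f, OF _ that]) (subst g(4), blast)
  have later: "(a n \<in> A m) = (\<not> c n)" if "n < m" for n m
  proof -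
    have "A m \<in> f (Suc n)" using dec[of "Suc n" m] g(1)[of m] that by auto
    then show ?thesis unfolding g(4)[of n] by blast
  qed
  have "UNIV \<subseteq> {n. c n = True} \<union> {n. c n = False}" by blast
  from infinite_super[OF this] have "infinite {n. c n = True} \<or> infinite {n. c n = False}"
    unfolding infinite_Un by simp
  then obtain b where b: "infinite {n. c n = b}" by blast
  define h where "h = enumerate {n. c n = b}"
  have h: "c (h n) = b" for n using enumerate_in_set[OF b] unfolding h_def by blast
  have hm: "h n < h m" if "n < m" for n m
    unfolding h_def using enumerate_mono[OF that b] .
  show thesis
  proof (rule that[of "\<lambda>n. A (h n)" "\<lambda>n. a (h n)" b])
    show "A (h n) \<in> F" for n using f[of "h n"] g(1)[of "h n"] by (rule subsetD)
    show "a (h n) \<in> \<Union>F" for n by (rule g(2))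
    show "a (h n) \<in> A (h n) \<longleftrightarrow> b" for n using g(3)[of "h n"] h by simp
    show "a (h n) \<in> A (h m) \<longleftrightarrow> \<not> b" if "n < m" for n m using later[OF hm[OF that]] h by simp
  qed
qed


section \<open>Definability of traces on \<open>G\<close> and symmetry of predictions\<close>

locale stable_extension =
  fixes G H :: "'a graph"
  assumes graph: "is_graph H"
    and elementary: "elementary_substructure G H"
    and mstable: "monadically_stable H"
begin

lemma GH: "verts G \<subseteq> verts H"
  using elementary by (simp add: elementary_substructure_def)

lemma adj_sym: "adj H x y \<longleftrightarrow> adj H y x"
  using graph by (auto simp: is_graph_def)

text \<open>Having a given atomic type over a finite \<open>T\<close> is definable over
  \<open>G\<close>, so \<open>elementary_reflect\<close> supplies a copy in
  \<open>G\<close>.\<close>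

lemma approx:
  assumes "finite T" "T \<subseteq> verts G" "w \<in> verts H"
  obtains g where "g \<in> verts G" "atype H T g = atype H T w"
proof -
  have "definable H (verts G) 1 (\<lambda>e. atype H T (e ! 0) = atype H T w)"
    using assms GH by (intro definable_atype) auto
  from elementary_reflect[OF elementary this, of "[w]"] assms(3)
  obtain e where "length e = 1" "set e \<subseteq> verts G" "atype H T (e ! 0) = atype H T w" by auto
  then show thesis using that[of "e ! 0"] by (cases e) auto
qed

definition app :: "'a set \<Rightarrow> 'a \<Rightarrow> 'a" where
  "app T w = (SOME g. g \<in> verts G \<and> atype H T g = atype H T w)"

lemma app:
  assumes "finite T" "T \<subseteq> verts G" "w \<in> verts H"
  shows "app T w \<in> verts G \<and> atype H T (app T w) = atype H T w"
  unfolding app_def by (rule someI_ex) (use approx[OF assms] in blast)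

text \<open>Otherwise every finite \<open>S\<close> leaves a pair of equal type over
  \<open>S\<close> that \<open>w\<close> distinguishes. Choosing alternately such a pair and a copy
  of \<open>w\<close> over all earlier vertices gives an order: a copy distinguishes the pairs
  chosen before it, as \<open>w\<close> does, but none of the later ones.\<close>

lemma trace_definable:
  assumes w: "w \<in> verts H"
  obtains S where "finite S" "S \<subseteq> verts G"
    "\<And>g g'. g \<in> verts G \<Longrightarrow> g' \<in> verts G \<Longrightarrow> atype H S g = atype H S g' \<Longrightarrow> adj H w g \<longleftrightarrow> adj H w g'"
proof (rule ccontr)
  assume "\<not> thesis"
  then have "\<forall>S. \<exists>z. finite S \<and> S \<subseteq> verts G \<longrightarrow> fst z \<in> verts G \<and> snd z \<in> verts G \<and>
      atype H S (fst z) = atype H S (snd z) \<and> adj H w (fst z) \<and> \<not> adj H w (snd z)"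
    using that by (metis fst_conv snd_conv)
  then obtain z where z: "\<forall>S. finite S \<and> S \<subseteq> verts G \<longrightarrow> fst (z S) \<in> verts G \<and> snd (z S) \<in> verts G \<and>
      atype H S (fst (z S)) = atype H S (snd (z S)) \<and> adj H w (fst (z S)) \<and> \<not> adj H w (snd (z S))"
    by (rule choice[THEN exE])
  define p p' where "p S = fst (z S)" and "p' S = snd (z S)" for S
  have p: "p S \<in> verts G \<and> p' S \<in> verts G \<and>
      atype H S (p S) = atype H S (p' S) \<and> adj H w (p S) \<and> \<not> adj H w (p' S)"
    if "finite S" "S \<subseteq> verts G" for S
    using z that unfolding p_def p'_def by blast
  define q where "q S = app S w" for S
  have q: "q S \<in> verts G \<and> atype H S (q S) = atype H S w" if "finite S" "S \<subseteq> verts G" for S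
    unfolding q_def using app[OF that w] .
  define U where "U T = T \<union> {p T, p' T}" for T
  \<comment> \<open>Each stage first adds the pair and then a copy of \<open>w\<close> over the set
    including that pair, so that the case \<open>i = j\<close> counts as earlier.\<close>
  define T where "T = rec_nat {} (\<lambda>_ T. U T \<union> {q (U T)})"
  have TS: "T (Suc n) = U (T n) \<union> {q (U (T n))}" for n by (simp add: T_def)
  have T: "finite (T n) \<and> T n \<subseteq> verts G" for n
  proof (induction n)
    case (Suc n)
    then have "finite (U (T n)) \<and> U (T n) \<subseteq> verts G" using p[of "T n"] by (auto simp: U_def)
    then show ?case using q[of "U (T n)"] by (auto simp: TS)
  qed (simp add: T_def)
  have UT: "finite (U (T n)) \<and> U (T n) \<subseteq> verts G" for n
    using T[of n] p[of "T n"] by (auto simp: U_def)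
  have mono: "T n \<subseteq> T m" if "n \<le> m" for n m
    by (rule lift_Suc_mono_le[of T, OF _ that]) (auto simp: TS U_def)
  define g g' s where "g n = p (T n)" and "g' n = p' (T n)" and "s n = q (U (T n))" for n
  have inG: "g n \<in> verts G" "g' n \<in> verts G" "s n \<in> verts G" for n
    using p[of "T n"] q[of "U (T n)"] T[of n] UT[of n] by (auto simp: g_def g'_def s_def)
  have ord: "adj H (g i) (s j) \<and> \<not> adj H (g' i) (s j) \<longleftrightarrow> i \<le> j" for i j
  proof (cases "i \<le> j")
    case True
    have "g i \<in> U (T i)" "g' i \<in> U (T i)" by (auto simp: g_def g'_def U_def)
    moreover have "U (T i) \<subseteq> U (T j)"
      using mono[of "Suc i" j] True by (cases "i = j") (auto simp: TS U_def)
    ultimately have "adj H (s j) (g i) \<longleftrightarrow> adj H w (g i)" "adj H (s j) (g' i) \<longleftrightarrow> adj H w (g' i)"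
      using q[of "U (T j)"] UT[of j] unfolding s_def atype_eq_iff by blast+
    then show ?thesis using p[of "T i"] T[of i] True adj_sym[of "g i"] adj_sym[of "g' i"]
      by (auto simp: g_def g'_def)
  next
    case False
    have "s j \<in> T (Suc j)" by (auto simp: TS s_def)
    then have "s j \<in> T i" using mono[of "Suc j" i] False by auto
    then have "adj H (g i) (s j) \<longleftrightarrow> adj H (g' i) (s j)"
      using p[of "T i"] T[of i] unfolding g_def g'_def atype_eq_iff by blast
    then show ?thesis using False by auto
  qed
  have "definable H (verts H) (2 + 1) (\<lambda>e. adj H (e ! 0) (e ! 2) \<and> \<not> adj H (e ! 1) (e ! 2))"
    by (intro definable_and definable_not definable_adj) auto
  from no_order[OF mstable this, of "\<lambda>i. [g i, g' i]" "\<lambda>i. [s i]" w]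
  show False using inG GH w ord by auto
qed

text \<open>\<open>gen w x\<close> is the prediction that the type of \<open>w\<close> over \<open>G\<close> makes for the
  adjacency of \<open>w\<close> and \<open>x\<close>.\<close>

definition gen :: "'a \<Rightarrow> 'a \<Rightarrow> bool" where
  "gen w x \<longleftrightarrow> (\<exists>S. finite S \<and> S \<subseteq> verts G \<and>
     (\<forall>g\<in>verts G. atype H S g = atype H S x \<longrightarrow> adj H w g))"

definition decides :: "'a set \<Rightarrow> 'a \<Rightarrow> bool" where
  "decides S w \<longleftrightarrow> finite S \<and> S \<subseteq> verts G \<and>
     (\<forall>g\<in>verts G. \<forall>g'\<in>verts G. atype H S g = atype H S g' \<longrightarrow> (adj H w g \<longleftrightarrow> adj H w g'))"

lemma ex_decides:
  assumes "w \<in> verts H"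
  obtains S where "decides S w"
  by (rule trace_definable[OF assms], rule that, unfold decides_def, intro conjI ballI impI)

lemma decidesD:
  assumes "decides S w" "g \<in> verts G" "g' \<in> verts G" "atype H S g = atype H S g'"
  shows "adj H w g \<longleftrightarrow> adj H w g'"
  using assms unfolding decides_def by metis

lemma decides_finite: "decides S w \<Longrightarrow> finite S" and decides_subset: "decides S w \<Longrightarrow> S \<subseteq> verts G"
  unfolding decides_def by blast+

lemma decides_mono:
  assumes "decides S w" "S \<subseteq> T" "finite T" "T \<subseteq> verts G"
  shows "decides T w"
  unfolding decides_def
  by (intro conjI ballI impI assms) (rule decidesD[OF assms(1)], auto intro: atype_antimono[OF _ assms(2)])

text \<open>If \<open>gen\<close> is witnessed by another set \<open>S'\<close>, a copy of
  \<open>x\<close> over \<open>S \<union> S'\<close> links the two: it is adjacent to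
  \<open>w\<close> by the choice of \<open>S'\<close>, and \<open>S\<close> does not tell it from
  \<open>g\<close>.\<close>

lemma decides_gen:
  assumes "decides S w" "x \<in> verts H" "g \<in> verts G" "atype H S g = atype H S x"
  shows "adj H w g \<longleftrightarrow> gen w x"
proof
  assume "adj H w g"
  then show "gen w x"
    unfolding gen_def using assms(4) decidesD[OF assms(1,3)]
    by (intro exI[of _ S] conjI ballI impI decides_finite[OF assms(1)] decides_subset[OF assms(1)]) simp
next
  assume "gen w x"
  then obtain S' where S': "finite S'" "S' \<subseteq> verts G"
    "\<And>g. g \<in> verts G \<Longrightarrow> atype H S' g = atype H S' x \<Longrightarrow> adj H w g"
    unfolding gen_def by blast
  have S: "finite S" "S \<subseteq> verts G" by (fact decides_finite[OF assms(1)], fact decides_subset[OF assms(1)])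
  obtain h where h: "h \<in> verts G" "atype H (S \<union> S') h = atype H (S \<union> S') x"
    using approx[of "S \<union> S'" x] S S' assms(2) by auto
  have "atype H S h = atype H S x" "atype H S' h = atype H S' x"
    using h(2) by (auto intro: atype_antimono)
  then have "adj H w h" "atype H S h = atype H S g" using S'(3) h(1) assms(4) by auto
  then show "adj H w g" using decidesD[OF assms(1) h(1) assms(3)] by simp
qed

lemma gen_G:
  assumes "w \<in> verts H" "x \<in> verts G"
  shows "gen w x \<longleftrightarrow> adj H w x"
proof -
  obtain S where "decides S w" by (rule ex_decides[OF assms(1)])
  from decides_gen[OF this, of x x] show ?thesis using assms GH by auto
qed

lemma gen_cong:
  assumes "decides S w" "x \<in> verts H" "y \<in> verts H" "atype H S x = atype H S y"
  shows "gen w x \<longleftrightarrow> gen w y"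
proof -
  obtain g where "g \<in> verts G" "atype H S g = atype H S x"
    by (rule approx[OF decides_finite[OF assms(1)] decides_subset[OF assms(1)] assms(2)])
  then show ?thesis using decides_gen[OF assms(1), of x g] decides_gen[OF assms(1), of y g] assms by auto
qed

text \<open>This is Harrington's symmetry argument. \<open>C n\<close> and \<open>D n\<close> are
  alternating copies of \<open>w\<close> and \<open>x\<close> in \<open>G\<close>, each over the
  earlier ones. A \<open>D\<close> after a \<open>C\<close> follows the prediction of
  \<open>x\<close>, a \<open>C\<close> after a \<open>D\<close> that of \<open>w\<close>; if these
  differ, the two sequences are ordered by nonadjacency.\<close>

lemma gen_sym_aux:
  assumes "w \<in> verts H" "x \<in> verts H" "gen w x"
  shows "gen x w"
proof (rule ccontr)
  assume neg: "\<not> gen x w"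
  obtain S1 where "decides S1 w" by (rule ex_decides[OF assms(1)])
  moreover obtain S2 where "decides S2 x" by (rule ex_decides[OF assms(2)])
  ultimately have S: "decides (S1 \<union> S2) w" "decides (S1 \<union> S2) x"
    by (auto intro!: decides_mono[of S1 w] decides_mono[of S2 x] dest: decides_finite decides_subset)
  define S where "S = S1 \<union> S2"
  have fin: "finite S" "S \<subseteq> verts G" using decides_finite[OF S(1)] decides_subset[OF S(1)] unfolding S_def .
  define c where "c T = app T w" for T
  define d where "d T = app (insert (c T) T) x" for T
  define T where "T = rec_nat S (\<lambda>_ T. T \<union> {c T, d T})"
  have TS: "T (Suc n) = T n \<union> {c (T n), d (T n)}" for n by (simp add: T_def)
  have step: "c T \<in> verts G \<and> d T \<in> verts G \<and> atype H T (c T) = atype H T w \<and>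
      atype H (insert (c T) T) (d T) = atype H (insert (c T) T) x"
    if "finite T" "T \<subseteq> verts G" for T
    using app[of T w] app[of "insert (c T) T" x] that assms by (auto simp: c_def d_def)
  have T: "finite (T n) \<and> T n \<subseteq> verts G" for n
  proof (induction n)
    case (Suc n)
    then show ?case using step[of "T n"] by (simp add: TS)
  qed (use fin in \<open>simp add: T_def\<close>)
  have mono: "T n \<subseteq> T m" if "n \<le> m" for n m
    by (rule lift_Suc_mono_le[of T, OF _ that]) (auto simp: TS)
  have ST: "S \<subseteq> T n" for n using mono[of 0 n] by (simp add: T_def)
  define C D where "C n = c (T n)" and "D n = d (T n)" for n
  have CD: "C n \<in> verts G" "D n \<in> verts G" "atype H (T n) (C n) = atype H (T n) w"
    "atype H (insert (C n) (T n)) (D n) = atype H (insert (C n) (T n)) x" for n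
    using step T unfolding C_def D_def by blast+
  have tS: "atype H S (C n) = atype H S w" "atype H S (D n) = atype H S x" for n
    using atype_antimono[OF CD(3) ST[of n]] atype_antimono[OF CD(4), of S n] ST[of n] by auto
  have ord: "\<not> adj H (C i) (D j) \<longleftrightarrow> i \<le> j" for i j
  proof (cases "i \<le> j")
    case True
    have "C i \<in> insert (C j) (T j)"
      using mono[of "Suc i" j] True by (cases "i = j") (auto simp: TS C_def)
    then have "adj H (D j) (C i) \<longleftrightarrow> adj H x (C i)" using CD(4)[of j] unfolding atype_eq_iff by blast
    also have "\<dots> \<longleftrightarrow> gen x w"
      using decides_gen[OF S(2) assms(1) CD(1)[of i]] tS by (simp add: S_def)
    finally show ?thesis using neg True adj_sym[of "C i" "D j"] by simp
  next
    case False
    have "D j \<in> T (Suc j)" by (auto simp: TS D_def)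
    then have "D j \<in> T i" using mono[of "Suc j" i] False by auto
    then have "adj H (C i) (D j) \<longleftrightarrow> adj H w (D j)" using CD(3)[of i] unfolding atype_eq_iff by blast
    also have "\<dots> \<longleftrightarrow> gen w x"
      using decides_gen[OF S(1) assms(2) CD(2)[of j]] tS by (simp add: S_def)
    finally show ?thesis using assms(3) False by simp
  qed
  have "definable H (verts H) (1 + 1) (\<lambda>e. \<not> adj H (e ! 0) (e ! 1))"
    by (intro definable_not definable_adj) auto
  from no_order[OF mstable this, of "\<lambda>i. [C i]" "\<lambda>i. [D i]" w]
  show False using CD(1,2) GH assms(1) ord by auto
qed

lemma gen_sym: "w \<in> verts H \<Longrightarrow> x \<in> verts H \<Longrightarrow> gen w x \<longleftrightarrow> gen x w"
  using gen_sym_aux by blast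

text \<open>The limit of all flips definable over finite subsets of \<open>G\<close>.\<close>

definition limit :: "'a graph" where
  "limit = \<lparr>verts = verts H,
     adj = \<lambda>w x. w \<in> verts H \<and> x \<in> verts H \<and> w \<noteq> x \<and> (adj H w x \<longleftrightarrow> \<not> gen w x)\<rparr>"

lemma limit_adj:
  "adj limit w x \<longleftrightarrow> w \<in> verts H \<and> x \<in> verts H \<and> w \<noteq> x \<and> (adj H w x \<longleftrightarrow> \<not> gen w x)"
  by (simp add: limit_def)

section \<open>Distances in the limit graph\<close>

text \<open>Predictions about vertices of \<open>G\<close> are correct by
  \<open>gen_G\<close>.\<close>

lemma limit_adj_notin: "adj limit w x \<Longrightarrow> x \<notin> verts G"
  using gen_G by (auto simp: limit_adj)

lemma near_limit_notin: "near limit r c x \<Longrightarrow> c \<notin> verts G \<Longrightarrow> x \<notin> verts G"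
  by (induction r arbitrary: x) (auto simp: near_Suc dest: limit_adj_notin)

lemma near_limit_verts: "near limit r c x \<Longrightarrow> c \<in> verts H \<Longrightarrow> x \<in> verts H"
  by (induction r arbitrary: x) (auto simp: near_Suc limit_adj)

text \<open>Let \<open>w\<close> and \<open>x\<close> be linked but not adjacent in
  \<open>H'\<close>. Copies \<open>d\<close> of \<open>x\<close> and \<open>c\<close> of
  \<open>w\<close> in \<open>G\<close> behave as predicted, that is, oppositely to \<open>w\<close>
  and \<open>x\<close>, while the flip treats all these pairs alike. So \<open>w\<close>,
  \<open>d\<close>, \<open>c\<close>, \<open>x\<close> is a path in \<open>H'\<close>.\<close>

lemma limit_near_flip:
  assumes fl: "coherent_flip H S H'" and S: "finite S" "S \<subseteq> verts G" and "adj limit w x"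
  shows "near H' 3 w x"
proof (cases "adj H' w x")
  case True
  then show ?thesis using near_mono[OF near_adj] by force
next
  case False
  have wx: "w \<in> verts H" "x \<in> verts H" "w \<noteq> x" "adj H w x \<longleftrightarrow> \<not> gen w x"
    using assms(4) by (auto simp: limit_adj)
  have notG: "x \<notin> verts G" "w \<notin> verts G"
    using limit_adj_notin[OF assms(4)] limit_adj_notin[of x w] assms(4) gen_sym adj_sym
    by (auto simp: limit_adj)
  obtain S1 where "decides S1 w" by (rule ex_decides[OF wx(1)])
  obtain S2 where "decides S2 x" by (rule ex_decides[OF wx(2)])
  define T where "T = S \<union> S1 \<union> S2"
  have T: "decides T w" "decides T x" and ST: "S \<subseteq> T"
    using \<open>decides S1 w\<close> \<open>decides S2 x\<close> S
    by (auto intro!: decides_mono[of S1 w] decides_mono[of S2 x] dest: decides_finite decides_subset simp: T_def)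
  have finT: "finite T" "T \<subseteq> verts G"
    by (fact decides_finite[OF T(1)], fact decides_subset[OF T(1)])
  have E1: "adj H' w g" if g: "g \<in> verts G" "atype H T g = atype H T x" for g
  proof -
    have "w \<noteq> g" "g \<in> verts H" using g notG GH by auto
    moreover have "adj H w g \<longleftrightarrow> gen w x" using decides_gen[OF T(1) wx(2) g] .
    ultimately show ?thesis
      using coherent_flipD[OF fl wx(1,2) wx(1), of g] atype_antimono[OF g(2) ST] wx False by auto
  qed
  have E2: "adj H' x g" if g: "g \<in> verts G" "atype H T g = atype H T w" for g
  proof -
    have "x \<noteq> g" "g \<in> verts H" using g notG GH by auto
    moreover have "adj H x g \<longleftrightarrow> gen x w" using decides_gen[OF T(2) wx(1) g] .
    moreover have "\<not> adj H' x w" using False fl by (auto simp: coherent_flip_def is_graph_def)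
    ultimately show ?thesis
      using coherent_flipD[OF fl wx(2,1) wx(2), of g] atype_antimono[OF g(2) ST] wx
        gen_sym[OF wx(1,2)] adj_sym[of w x] by auto
  qed
  obtain d where d: "d \<in> verts G" "atype H T d = atype H T x" using approx[OF finT wx(2)] by blast
  \<comment> \<open>\<open>c\<close> copies \<open>w\<close> over \<open>d\<close> as well, which
    makes \<open>c\<close> and \<open>d\<close> distinct and related like \<open>w\<close> and
    \<open>d\<close>.\<close>
  obtain c where c: "c \<in> verts G" "atype H (insert d T) c = atype H (insert d T) w"
    using approx[of "insert d T" w] finT d wx by auto
  have cT: "atype H T c = atype H T w" using c(2) by (rule atype_antimono) auto
  have "c \<noteq> d" "adj H c d \<longleftrightarrow> adj H w d" using c(2) d notG unfolding atype_eq_iff by auto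
  moreover have "w \<noteq> d" "c \<in> verts H" "d \<in> verts H" using notG d c GH by auto
  ultimately have "adj H' c d"
    using coherent_flipD[OF fl wx(1), of d c d] atype_antimono[OF cT ST] E1[OF d] by auto
  then have "near H' 1 w d" "near H' 1 d c" "near H' 1 c x"
    using E1[OF d] E2[OF c(1) cT] fl by (auto simp: coherent_flip_def is_graph_def intro!: near_adj)
  then have "near H' (1 + 1 + 1) w x" by (blast intro: near_trans)
  then show ?thesis by (simp add: numeral_3_eq_3)
qed

lemma near_limit_flip:
  assumes "coherent_flip H S H'" "finite S" "S \<subseteq> verts G" "near limit r w x"
  shows "near H' (3 * r) w x"
  using assms(4)
proof (induction r arbitrary: x)
  case (Suc r)
  consider "near limit r w x" | z where "near limit r w z" "adj limit z x"
    using Suc.prems by (auto simp: near_Suc)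
  then show ?case
  proof cases
    case 1
    then show ?thesis using near_mono[OF Suc.IH] by force
  next
    case 2
    then show ?thesis
      using near_trans[OF Suc.IH limit_near_flip[OF assms(1-3)]] by (auto simp: algebra_simps)
  qed
qed simp

section \<open>Finiteness of traces in balls\<close>

definition trace :: "'a \<Rightarrow> 'a set" where
  "trace w = {g \<in> verts G. adj H w g}"

text \<open>Vertices with the same trace share a deciding set, so one finite set decides all of
  \<open>B\<close>. Once it also separates the traces, the type of a vertex of \<open>B\<close> over
  it determines its trace; hence predictions for vertices of \<open>B\<close> depend on types only,
  and a flip along them gives the limit there.\<close>

lemma ex_flip_agreeing_with_limit:
  assumes B: "B \<subseteq> verts H" and fin: "finite (trace ` B)"
  obtains S H' where "finite S" "S \<subseteq> verts G" "coherent_flip H S H'"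
    "\<And>w x. w \<in> B \<Longrightarrow> adj H' w x \<longleftrightarrow> adj limit w x"
proof -
  have "\<forall>t\<in>trace ` B. \<exists>S. \<forall>w\<in>B. trace w = t \<longrightarrow> decides S w"
  proof
    fix t assume "t \<in> trace ` B"
    then obtain w where w: "w \<in> B" "t = trace w" by blast
    then obtain S where S: "decides S w" using ex_decides[of w] B by blast
    have "decides S w'" if "trace w' = trace w" for w'
    proof -
      have "\<forall>g\<in>verts G. adj H w' g \<longleftrightarrow> adj H w g" using that by (auto simp: trace_def)
      then show ?thesis
        unfolding decides_def using decides_finite[OF S] decides_subset[OF S] decidesD[OF S] by metis
    qed
    then show "\<exists>S. \<forall>w\<in>B. trace w = t \<longrightarrow> decides S w" using w by blast
  qed
  from bchoice[OF this] obtain Q where Q: "\<And>w. w \<in> B \<Longrightarrow> decides (Q (trace w)) w" by blast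
  define sep :: "'a set \<Rightarrow> 'a set \<Rightarrow> 'a" where "sep t t' = (SOME g. (g \<in> t) \<noteq> (g \<in> t'))" for t t'
  have sep: "(sep t t' \<in> t) \<noteq> (sep t t' \<in> t')" if "t \<noteq> t'" for t t'
    unfolding sep_def by (rule someI_ex) (use that in blast)
  define S where "S = (\<Union>t\<in>trace ` B. Q t) \<union> {sep t t' |t t'. t \<in> trace ` B \<and> t' \<in> trace ` B \<and> t \<noteq> t'}"
  have "{sep t t' |t t'. t \<in> trace ` B \<and> t' \<in> trace ` B \<and> t \<noteq> t'} \<subseteq>
      (\<lambda>(t, t'). sep t t') ` (trace ` B \<times> trace ` B)" by blast
  then have "finite {sep t t' |t t'. t \<in> trace ` B \<and> t' \<in> trace ` B \<and> t \<noteq> t'}"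
    using fin by (meson finite_SigmaI finite_imageI finite_subset)
  moreover have "finite (\<Union>t\<in>trace ` B. Q t)" using fin by (rule finite_UN_I) (use Q in \<open>blast dest: decides_finite\<close>)
  ultimately have S1: "finite S" by (simp add: S_def)
  have "sep t t' \<in> t \<union> t'" if "t \<noteq> t'" for t t' using sep[OF that] by blast
  moreover have "t \<subseteq> verts G" if "t \<in> trace ` B" for t using that by (auto simp: trace_def)
  ultimately have "{sep t t' |t t'. t \<in> trace ` B \<and> t' \<in> trace ` B \<and> t \<noteq> t'} \<subseteq> verts G"
    by blast
  moreover have "Q t \<subseteq> verts G" if "t \<in> trace ` B" for t
    using that Q by (blast dest: decides_subset)
  ultimately have S2: "S \<subseteq> verts G" unfolding S_def by blast
  have dec: "decides S w" if "w \<in> B" for w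
    using decides_mono[OF Q[OF that] _ S1 S2] that by (auto simp: S_def)
  have tr: "trace w = trace w'" if "w \<in> B" "w' \<in> B" "atype H S w = atype H S w'" for w w'
  proof (rule ccontr)
    assume ne: "trace w \<noteq> trace w'"
    let ?g = "sep (trace w) (trace w')"
    have "?g \<in> S" unfolding S_def using that ne by blast
    then have "adj H w ?g \<longleftrightarrow> adj H w' ?g" using that(3) unfolding atype_eq_iff by blast
    moreover have "?g \<in> verts G" using \<open>?g \<in> S\<close> S2 by blast
    ultimately show False using sep[OF ne] by (simp add: trace_def)
  qed
  \<comment> \<open>Listing both orders makes the flip symmetric; by symmetry of \<open>gen\<close>
    the added pairs are predicted as well, which is checked in \<open>Dgen\<close>.\<close>
  define D where "D \<kappa> l \<longleftrightarrow> (\<exists>w\<in>B. \<exists>y\<in>verts H. gen w y \<and>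
      (atype H S w = \<kappa> \<and> atype H S y = l \<or> atype H S w = l \<and> atype H S y = \<kappa>))" for \<kappa> l
  have Dsym: "D \<kappa> l \<longleftrightarrow> D l \<kappa>" for \<kappa> l unfolding D_def by blast
  have Dgen: "D (atype H S w) (atype H S x) \<longleftrightarrow> gen w x" if w: "w \<in> B" and x: "x \<in> verts H" for w x
  proof
    assume "D (atype H S w) (atype H S x)"
    then obtain w' y where w': "w' \<in> B" "y \<in> verts H" "gen w' y" and
      alt: "atype H S w' = atype H S w \<and> atype H S y = atype H S x \<or>
        atype H S w' = atype H S x \<and> atype H S y = atype H S w"
      unfolding D_def by blast
    from alt show "gen w x"
    proof
      assume *: "atype H S w' = atype H S w \<and> atype H S y = atype H S x"
      obtain g where g: "g \<in> verts G" "atype H S g = atype H S y" using approx[OF S1 S2 w'(2)] by blast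
      have "adj H w' g" using decides_gen[OF dec[OF w'(1)] w'(2) g] w'(3) by simp
      then have "adj H w g" using tr[OF w'(1) w] * g(1) by (auto simp: trace_def)
      then show "gen w x" using decides_gen[OF dec[OF w] x g(1)] g(2) * by simp
    next
      assume *: "atype H S w' = atype H S x \<and> atype H S y = atype H S w"
      have "gen w' w" using gen_cong[OF dec[OF w'(1)] w'(2), of w] * w'(3) w B by auto
      then have "gen w w'" using gen_sym_aux[of w' w] w w' B by auto
      then show "gen w x" using gen_cong[OF dec[OF w], of w' x] * w' x B by auto
    qed
  next
    assume "gen w x"
    then show "D (atype H S w) (atype H S x)" unfolding D_def using w x by blast
  qed
  define H' where "H' = \<lparr>verts = verts H, adj = \<lambda>a b. a \<in> verts H \<and> b \<in> verts H \<and> a \<noteq> b \<and>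
      (adj H a b \<longleftrightarrow> \<not> D (atype H S a) (atype H S b))\<rparr>"
  have "coherent_flip H S H'"
    unfolding coherent_flip_def is_graph_def H'_def using adj_sym Dsym by auto
  moreover have "adj H' w x \<longleftrightarrow> adj limit w x" if "w \<in> B" for w x
    using Dgen[OF that] that B by (auto simp: H'_def limit_adj)
  ultimately show thesis using that S1 S2 by blast
qed

text \<open>If a ball around \<open>v\<close> avoids \<open>G\<close> but has infinitely many traces on \<open>G\<close>, then copies
  \<open>v\<^sub>l\<close> of \<open>v\<close> in \<open>G\<close> and vertices \<open>a\<^sub>k\<close> separating the traces give ball elements
  \<open>w\<^sub>l\<^sub>k\<close> coding the pairs \<open>(l, k)\<close>; marking those with \<open>l < k\<close> defines a linear order.\<close>

lemma finite_traces_in_ball: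
  assumes fl: "coherent_flip H S H'" and S: "finite S" "S \<subseteq> verts G"
    and v: "v \<in> verts H" and av: "\<And>g. g \<in> verts G \<Longrightarrow> \<not> near H' r v g"
  shows "finite (trace ` {w \<in> verts H. near H' r v w})"
proof (rule ccontr)
  assume inf: "infinite (trace ` {w \<in> verts H. near H' r v w})"
  obtain A :: "nat \<Rightarrow> 'a set" and a c where A: "\<And>n. A n \<in> trace ` {w \<in> verts H. near H' r v w}"
    "\<And>n. a n \<in> \<Union> (trace ` {w \<in> verts H. near H' r v w})"
    "\<And>n. a n \<in> A n \<longleftrightarrow> c" "\<And>n m. n < m \<Longrightarrow> a n \<in> A m \<longleftrightarrow> \<not> c"
    by (rule infinite_family_sequence[OF inf], rule that)
  have aG: "a n \<in> verts G" for n using A(2)[of n] by (auto simp: trace_def)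
  have "\<forall>n. \<exists>x. x \<in> verts H \<and> near H' r v x \<and> A n = trace x" using A(1) by (auto simp: image_iff)
  from choice[OF this] obtain w
    where w: "\<And>n. w n \<in> verts H" "\<And>n. near H' r v (w n)" "\<And>n. A n = trace (w n)" by blast
  have wa: "adj H (w n) (a n) \<longleftrightarrow> c" "n < m \<Longrightarrow> adj H (w m) (a n) \<longleftrightarrow> \<not> c" for n m
    using A(3)[of n] A(4)[of n m] aG[of n] unfolding w(3) trace_def by simp_all
  have S': "S \<subseteq> verts H" using S GH by blast
  have "definable H (verts H) (Suc (1 + 1)) (\<lambda>e. near H' r (e ! 1) (e ! 0) \<and> (adj H (e ! 0) (e ! 2) \<longleftrightarrow> c))"
    by (intro definable_and definable_iff definable_const definable_adj
        definable_bin[OF definable_near[OF fl S(1) S']]) auto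
  then show False
  proof (rule no_order_marked[OF mstable])
    fix N :: nat
    assume N: "\<And>X x y. X \<subseteq> verts H \<Longrightarrow>
      (\<And>i. length (x i) = 1 \<and> set (x i) \<subseteq> verts H) \<Longrightarrow>
      (\<And>i. length (y i) = 1 \<and> set (y i) \<subseteq> verts H) \<Longrightarrow>
      (\<And>i j. i < N \<Longrightarrow> j < N \<Longrightarrow> (\<exists>z\<in>X. near H' r ((z # x i @ y j) ! 1) ((z # x i @ y j) ! 0) \<and>
         (adj H ((z # x i @ y j) ! 0) ((z # x i @ y j) ! 2) \<longleftrightarrow> c)) \<longleftrightarrow> i \<le> j) \<Longrightarrow> False"
    \<comment> \<open>\<open>L\<close> lists a copy of \<open>v\<close> followed by copies of
      \<open>w 0\<close>, ..., \<open>w N\<close>. The last clause keeps this copy of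
      \<open>v\<close> far from all earlier copies of the \<open>w k\<close>; \<open>v\<close>
      itself satisfies it since those lie in \<open>G\<close>.\<close>
    define P where "P f l L \<longleftrightarrow> length L = Suc (Suc N) \<and> set L \<subseteq> verts G \<and>
        (\<forall>k\<in>{..N}. near H' r (L ! 0) (L ! Suc k) \<and> (\<forall>i\<in>{..N}. adj H (L ! Suc k) (a i) \<longleftrightarrow> adj H (w k) (a i))) \<and>
        (\<forall>l'\<in>{..<l}. \<forall>k\<in>{..N}. \<not> near H' r (L ! 0) (f l' ! Suc k))"
      for f :: "nat \<Rightarrow> 'a list" and l L
    have "\<exists>f. \<forall>l. P f l (f l)"
    proof (rule dependent_wellorder_choice)
      fix L and f g :: "nat \<Rightarrow> 'a list" and l :: nat
      assume "\<And>y. y < l \<Longrightarrow> f y = g y"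
      then show "P f l L = P g l L" by (simp add: P_def)
    next
      fix l :: nat and f :: "nat \<Rightarrow> 'a list"
      assume IH: "\<And>y. y < l \<Longrightarrow> P f y (f y)"
      have fG: "f l' ! Suc k \<in> verts G" if "l' < l" "k \<le> N" for l' k
      proof -
        have "length (f l') = Suc (Suc N)" "set (f l') \<subseteq> verts G"
          using IH[OF that(1)] unfolding P_def by blast+
        then show ?thesis using nth_mem[of "Suc k" "f l'"] that(2) by auto
      qed
      define R :: "'a list \<Rightarrow> bool" where "R L \<longleftrightarrow> (\<forall>k\<in>{..N}. near H' r (L ! 0) (L ! Suc k) \<and>
          (\<forall>i\<in>{..N}. adj H (L ! Suc k) (a i) \<longleftrightarrow> adj H (w k) (a i))) \<and>
        (\<forall>l'\<in>{..<l}. \<forall>k\<in>{..N}. \<not> near H' r (L ! 0) (f l' ! Suc k))" for L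
      have "definable H (verts G) (Suc (Suc N)) R"
        unfolding R_def
        by (intro definable_and definable_ball definable_iff definable_const definable_not
            definable_adj_param definable_bin[OF definable_near[OF fl S GH]]
            definable_bin_param[OF definable_near[OF fl S GH]])
          (auto simp: aG fG GH)
      moreover have "R (v # map w [0..<Suc N])"
        unfolding R_def using w(2) av fG by (auto simp del: upt_Suc simp: nth_map)
      moreover have "set (v # map w [0..<Suc N]) \<subseteq> verts H" using v w by auto
      ultimately obtain L where "length L = Suc (Suc N)" "set L \<subseteq> verts G" "R L"
        using elementary_reflect[OF elementary, of "Suc (Suc N)" R "v # map w [0..<Suc N]"] by auto
      then have "P f l L" unfolding P_def R_def by blast
      then show "\<exists>L. P f l L" by blast
    qed
    then obtain L where L: "\<And>l. P L l (L l)" by blast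
    define vv where "vv l = L l ! 0" for l
    define ww where "ww l k = L l ! Suc k" for l k
    have LG: "length (L l) = Suc (Suc N)" "set (L l) \<subseteq> verts G" for l
      using L[of l] unfolding P_def by blast+
    have inH: "vv l \<in> verts H" "k \<le> N \<Longrightarrow> ww l k \<in> verts H" for l k
      unfolding vv_def ww_def
      by (auto intro!: subsetD[OF GH] subsetD[OF LG(2)[of l]] nth_mem simp: LG(1))
        (use LG(1)[of l] in simp)
    have L1: "\<forall>k\<in>{..N}. near H' r (L l ! 0) (L l ! Suc k) \<and>
          (\<forall>i\<in>{..N}. adj H (L l ! Suc k) (a i) \<longleftrightarrow> adj H (w k) (a i))" for l
      using L[of l] unfolding P_def by (elim conjE)
    have L2: "\<forall>l'\<in>{..<l}. \<forall>k\<in>{..N}. \<not> near H' r (L l ! 0) (L l' ! Suc k)" for l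
      using L[of l] unfolding P_def by (elim conjE)
    have n1: "near H' r (vv l) (ww l k)" if "k \<le> N" for l k
      using L1[of l] that unfolding vv_def ww_def by simp
    have n2: "j \<le> l" if "near H' r (vv j) (ww l k)" "k \<le> N" for j l k
      using L2[of j] that unfolding vv_def ww_def by (meson atMost_iff lessThan_iff not_le)
    have n3: "adj H (ww l k) (a i) \<longleftrightarrow> adj H (w k) (a i)" if "k \<le> N" "i \<le> N" for l k i
      using L1[of l] that unfolding ww_def by simp
    \<comment> \<open>If \<open>vv i\<close> is near a marked \<open>ww l k\<close> with the right
      adjacency to \<open>a (Suc j)\<close>, then \<open>i \<le> l < k \<le> Suc j\<close>; the
      index \<open>Suc j\<close> offsets the strict \<open>l < k\<close>.\<close>
    define X where "X = {ww l k |l k. l < k \<and> k \<le> N}"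
    show False
    proof (rule N[of X "\<lambda>i. [vv i]" "\<lambda>i. [a (Suc i)]"])
      fix i j assume ij: "i < N" "j < N"
      have "(\<exists>z\<in>X. near H' r (vv i) z \<and> (adj H z (a (Suc j)) \<longleftrightarrow> c)) \<longleftrightarrow> i \<le> j"
      proof
        assume "\<exists>z\<in>X. near H' r (vv i) z \<and> (adj H z (a (Suc j)) \<longleftrightarrow> c)"
        then obtain l k where lk: "l < k" "k \<le> N" "near H' r (vv i) (ww l k)"
          "adj H (ww l k) (a (Suc j)) \<longleftrightarrow> c"
          unfolding X_def by blast
        have "\<not> Suc j < k" using wa(2)[of "Suc j" k] n3[of k "Suc j" l] lk ij by auto
        then show "i \<le> j" using n2[OF lk(3,2)] lk(1) by simp
      next
        assume "i \<le> j"
        then have "ww i (Suc j) \<in> X" unfolding X_def using ij by (intro CollectI exI[of _ i] exI[of _ "Suc j"]) simp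
        moreover have "near H' r (vv i) (ww i (Suc j))" using n1 ij by simp
        moreover have "adj H (ww i (Suc j)) (a (Suc j)) \<longleftrightarrow> c"
          using n3[of "Suc j" "Suc j" i] wa(1)[of "Suc j"] ij by simp
        ultimately show "\<exists>z\<in>X. near H' r (vv i) z \<and> (adj H z (a (Suc j)) \<longleftrightarrow> c)" by blast
      qed
      then show "(\<exists>z\<in>X. near H' r ((z # [vv i] @ [a (Suc j)]) ! 1) ((z # [vv i] @ [a (Suc j)]) ! 0) \<and>
         (adj H ((z # [vv i] @ [a (Suc j)]) ! 0) ((z # [vv i] @ [a (Suc j)]) ! 2) \<longleftrightarrow> c)) \<longleftrightarrow> i \<le> j"
        by simp
    qed (use inH aG GH in \<open>auto simp: X_def\<close>)
  qed
qed

text \<open>Finitely many traces at radius \<open>r\<close> give a flip that agrees with the limit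
  on edges leaving the ball; by \<open>near_agree\<close> the ball of radius \<open>Suc r\<close> is
  then a ball of that flip. It avoids \<open>G\<close>, so \<open>finite_traces_in_ball\<close>
  applies.\<close>

lemma finite_traces_in_limit_ball:
  assumes c: "c \<in> verts H - verts G"
  shows "finite (trace ` {w \<in> verts H. near limit r c w})"
proof (induction r)
  case 0
  have "{w \<in> verts H. near limit 0 c w} \<subseteq> {c}" by auto
  then show ?case by (meson finite.emptyI finite.insertI finite_imageI finite_subset)
next
  case (Suc r)
  obtain S H' where S: "finite S" "S \<subseteq> verts G" "coherent_flip H S H'"
    and ag: "\<And>w x. w \<in> {w \<in> verts H. near limit r c w} \<Longrightarrow> adj H' w x \<longleftrightarrow> adj limit w x"
    using ex_flip_agreeing_with_limit[OF _ Suc] by blast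
  have "w \<in> verts H" if "near limit r c w" for w
    using near_limit_verts[OF that] c by blast
  then have eq: "near H' (Suc r) c x \<longleftrightarrow> near limit (Suc r) c x" for x
    using near_agree[of limit r c H' "Suc r"] ag by auto
  have "\<not> near H' (Suc r) c g" if "g \<in> verts G" for g
    using near_limit_notin[of "Suc r" c g] c that eq by blast
  from finite_traces_in_ball[OF S(3,1,2) _ this]
  show ?case using c eq by auto
qed

text \<open>The union of the finitely many balls still has finitely many traces, so one flip serves
  all centres in \<open>U\<close>.\<close>

theorem separating_flip:
  assumes U: "finite U" "U \<subseteq> verts H - verts G"
  obtains S H' where "finite S" "S \<subseteq> verts G" "coherent_flip H S H'"
    "\<And>c x. c \<in> U \<Longrightarrow> near H' r c x \<longleftrightarrow> near limit r c x"
    "\<And>c g. c \<in> U \<Longrightarrow> g \<in> verts G \<Longrightarrow> \<not> near H' r c g"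
proof -
  define B where "B = (\<Union>c\<in>U. {w \<in> verts H. near limit r c w})"
  have "finite (trace ` B)"
    using U finite_traces_in_limit_ball unfolding B_def image_UN by blast
  then obtain S H' where S: "finite S" "S \<subseteq> verts G" "coherent_flip H S H'"
    and ag: "\<And>w x. w \<in> B \<Longrightarrow> adj H' w x \<longleftrightarrow> adj limit w x"
    using ex_flip_agreeing_with_limit[of B] unfolding B_def by blast
  have inH: "w \<in> verts H" if "near limit s c w" "c \<in> U" for w c s
    using near_limit_verts[OF that(1)] that(2) U by blast
  have eq: "near H' r c x \<longleftrightarrow> near limit r c x" if "c \<in> U" for c x
  proof (rule near_agree[of limit r])
    fix w x assume "near limit r c w"
    then have "w \<in> B" unfolding B_def using that inH by blast
    then show "adj H' w x \<longleftrightarrow> adj limit w x" by (rule ag)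
  qed simp
  show thesis
    using that[OF S] eq near_limit_notin U by blast
qed

end


section \<open>A back-and-forth argument in flips\<close>

fun qrank :: "fm \<Rightarrow> nat" where
  "qrank (FEq i j) = 0"
| "qrank (FEdge i j) = 0"
| "qrank (FPred k i) = 0"
| "qrank (FNot \<phi>) = qrank \<phi>"
| "qrank (FAnd \<phi> \<psi>) = max (qrank \<phi>) (qrank \<psi>)"
| "qrank (FEx \<phi>) = Suc (qrank \<phi>)"

lemma all_less_Suc_Cons:
  "(\<forall>i<length (x # e). P i) \<longleftrightarrow> P 0 \<and> (\<forall>i<length e. P (Suc i))"
  using less_Suc_eq_0_disj by auto

locale flip_game =
  fixes H H' :: "'a graph" and S :: "'a set" and T :: nat
  assumes graph_H: "is_graph H" and flip: "coherent_flip H S H'" and finite_S: "finite S"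
begin

lemma graph_H': "is_graph H'"
  using flip by (auto simp: coherent_flip_def)

text \<open>Distances are recorded only up to \<open>T\<close>, which leaves finitely many
  signatures of each length. Distance 0 records equality.\<close>

definition sig :: "'a list \<Rightarrow> ('a set \<times> 'a set) list \<times> (nat \<times> nat \<times> nat) set" where
  "sig xs = (map (atype H S) xs,
     {(i, j, t). i < length xs \<and> j < length xs \<and> t \<le> T \<and> near H' t (xs ! i) (xs ! j)})"

lemma sig_eq_iff:
  "sig xs = sig ys \<longleftrightarrow> length xs = length ys \<and>
     (\<forall>i\<in>{..<length xs}. atype H S (ys ! i) = atype H S (xs ! i)) \<and>
     (\<forall>i\<in>{..<length xs}. \<forall>j\<in>{..<length xs}. \<forall>t\<in>{..T}.
        near H' t (ys ! i) (ys ! j) \<longleftrightarrow> near H' t (xs ! i) (xs ! j))" (is "?L \<longleftrightarrow> ?R")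
proof
  assume s: ?L
  then have m: "map (atype H S) xs = map (atype H S) ys"
    and t: "{(i, j, t). i < length xs \<and> j < length xs \<and> t \<le> T \<and> near H' t (xs ! i) (xs ! j)} =
      {(i, j, t). i < length ys \<and> j < length ys \<and> t \<le> T \<and> near H' t (ys ! i) (ys ! j)}" (is "?A = ?B")
    by (auto simp: sig_def)
  have len: "length xs = length ys" using m by (rule map_eq_imp_length_eq)
  have "atype H S (ys ! i) = atype H S (xs ! i)" if "i < length xs" for i
    using arg_cong[OF m, of "\<lambda>l. l ! i"] that len by simp
  moreover have "near H' t (ys ! i) (ys ! j) \<longleftrightarrow> near H' t (xs ! i) (xs ! j)"
    if "i < length xs" "j < length xs" "t \<le> T" for i j t
  proof -
    have "(i, j, t) \<in> ?B \<longleftrightarrow> (i, j, t) \<in> ?A" using t by simp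
    then show ?thesis using that len by simp
  qed
  ultimately show ?R using len by simp
next
  assume r: ?R
  have "map (atype H S) xs = map (atype H S) ys" by (rule nth_equalityI) (use r in auto)
  moreover have "{(i, j, t). i < length xs \<and> j < length xs \<and> t \<le> T \<and> near H' t (xs ! i) (xs ! j)} =
      {(i, j, t). i < length ys \<and> j < length ys \<and> t \<le> T \<and> near H' t (ys ! i) (ys ! j)}"
    using r by auto
  ultimately show ?L by (simp add: sig_def)
qed

lemma sigD:
  assumes "sig xs = sig ys"
  shows "length ys = length xs"
    and "i < length xs \<Longrightarrow> atype H S (ys ! i) = atype H S (xs ! i)"
    and "i < length xs \<Longrightarrow> j < length xs \<Longrightarrow> t \<le> T \<Longrightarrow>
      near H' t (ys ! i) (ys ! j) \<longleftrightarrow> near H' t (xs ! i) (xs ! j)"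
  using assms unfolding sig_eq_iff by simp_all

text \<open>The Ehrenfeucht-Fraisse equivalence for \<open>k\<close> rounds, with signatures in
  place of atomic formulas.\<close>

primrec eqv :: "nat \<Rightarrow> 'a list \<Rightarrow> 'a list \<Rightarrow> bool" where
  "eqv 0 xs ys \<longleftrightarrow> sig xs = sig ys"
| "eqv (Suc k) xs ys \<longleftrightarrow> sig xs = sig ys \<and>
     (\<forall>x\<in>verts H. \<exists>y\<in>verts H. eqv k (x # xs) (y # ys)) \<and>
     (\<forall>y\<in>verts H. \<exists>x\<in>verts H. eqv k (x # xs) (y # ys))"

lemma eqv_sig: "eqv k xs ys \<Longrightarrow> sig xs = sig ys"
  by (cases k) auto

lemma eqv_refl: "eqv k xs xs"
  by (induction k arbitrary: xs) auto

lemma eqv_sym: "eqv k xs ys \<Longrightarrow> eqv k ys xs"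
proof (induction k arbitrary: xs ys)
  case (Suc k)
  show ?case
    unfolding eqv.simps
  proof (intro conjI ballI)
    show "sig ys = sig xs" using Suc.prems by simp
  next
    fix x assume "x \<in> verts H"
    then obtain y where "y \<in> verts H" "eqv k (y # xs) (x # ys)" using Suc.prems by auto
    then show "\<exists>y\<in>verts H. eqv k (x # ys) (y # xs)" using Suc.IH by blast
  next
    fix y assume "y \<in> verts H"
    then obtain x where "x \<in> verts H" "eqv k (y # xs) (x # ys)" using Suc.prems by auto
    then show "\<exists>x\<in>verts H. eqv k (x # ys) (y # xs)" using Suc.IH by blast
  qed
qed simp

section \<open>Finiteness and definability of the game equivalence\<close>

definition tuples :: "nat \<Rightarrow> 'a list set" where
  "tuples n = {xs. length xs = n \<and> set xs \<subseteq> verts H}"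

lemma finite_sig: "finite (sig ` tuples n)"
proof -
  have "sig ` tuples n \<subseteq> {ls. set ls \<subseteq> Pow S \<times> Pow S \<and> length ls = n} \<times>
      Pow ({..<n} \<times> {..<n} \<times> {..T})"
    by (auto simp: sig_def tuples_def atype_def)
  then show ?thesis
    by (rule finite_subset) (use finite_S in \<open>auto intro: finite_lists_length_eq\<close>)
qed

text \<open>A class of \<open>eqv (Suc k)\<close> is a function of a signature and a set of classes
  of \<open>eqv k\<close>, both with finitely many values at a fixed length. The universal
  quantifier over \<open>y\<close> is written with negations to match the closure rules of
  \<open>definable\<close>.\<close>

lemma eqv_Suc_image:
  "eqv (Suc k) xs = (\<lambda>(\<sigma>, \<Phi>) ys. \<sigma> = sig ys \<and> (\<forall>p\<in>\<Phi>. \<exists>y\<in>verts H. p (y # ys)) \<and>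
      \<not> (\<exists>y\<in>verts H. \<not> (\<exists>p\<in>\<Phi>. p (y # ys)))) (sig xs, (\<lambda>x. eqv k (x # xs)) ` verts H)"
  by (rule ext) auto

lemma finite_eqv: "finite (eqv k ` tuples n)"
proof (induction k arbitrary: n)
  case 0
  have "eqv 0 ` tuples n = (\<lambda>\<sigma> ys. \<sigma> = sig ys) ` sig ` tuples n"
    by (auto simp: image_image intro!: image_cong)
  then show ?case using finite_sig[of n] by (simp only: finite_imageI)
next
  case (Suc k)
  let ?F = "\<lambda>(\<sigma>, \<Phi>) ys. \<sigma> = sig ys \<and> (\<forall>p\<in>\<Phi>. \<exists>y\<in>verts H. p (y # ys)) \<and>
      \<not> (\<exists>y\<in>verts H. \<not> (\<exists>p\<in>\<Phi>. p (y # ys)))"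
  have "eqv (Suc k) ` tuples n \<subseteq> ?F ` (sig ` tuples n \<times> Pow (eqv k ` tuples (Suc n)))"
  proof
    fix p assume "p \<in> eqv (Suc k) ` tuples n"
    then obtain xs where xs: "xs \<in> tuples n" "p = eqv (Suc k) xs" by blast
    have "(\<lambda>x. eqv k (x # xs)) ` verts H \<in> Pow (eqv k ` tuples (Suc n))"
      using xs(1) by (auto simp: tuples_def)
    then show "p \<in> ?F ` (sig ` tuples n \<times> Pow (eqv k ` tuples (Suc n)))"
      unfolding xs(2) eqv_Suc_image using xs(1) by blast
  qed
  then show ?case by (rule finite_subset) (use Suc finite_sig in auto)
qed

lemma definable_sig:
  assumes A: "S \<subseteq> A" "A \<subseteq> verts H" and xs: "length xs = n"
  shows "definable H A n (\<lambda>ys. sig xs = sig ys)"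
proof -
  have "definable H A n (\<lambda>ys. (\<forall>i\<in>{..<n}. atype H S (ys ! i) = atype H S (xs ! i)) \<and>
     (\<forall>i\<in>{..<n}. \<forall>j\<in>{..<n}. \<forall>t\<in>{..T}. near H' t (ys ! i) (ys ! j) \<longleftrightarrow> near H' t (xs ! i) (xs ! j)))"
    by (intro definable_and definable_ball definable_iff definable_const definable_atype
        definable_bin[OF definable_near[OF flip]]) (use A finite_S in auto)
  then show ?thesis
    by (rule definable_cong) (use xs in \<open>simp add: sig_eq_iff\<close>)
qed

text \<open>The defining formulas are Hintikka formulas; finiteness of the set of classes keeps
  their conjunctions and disjunctions finite.\<close>

lemma definable_eqv:
  assumes A: "S \<subseteq> A" "A \<subseteq> verts H" and xs: "length xs = n" "set xs \<subseteq> verts H"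
  shows "definable H A n (eqv k xs)"
  using xs
proof (induction k arbitrary: n xs)
  case 0
  show ?case using definable_sig[OF A 0(1)] by simp
next
  case (Suc k)
  have "(\<lambda>x. eqv k (x # xs)) ` verts H \<subseteq> eqv k ` tuples (Suc n)"
    using Suc.prems by (auto simp: tuples_def)
  then have fin: "finite ((\<lambda>x. eqv k (x # xs)) ` verts H)" using finite_eqv finite_subset by blast
  have d: "definable H A (Suc n) p" if "p \<in> (\<lambda>x. eqv k (x # xs)) ` verts H" for p
    using that Suc.IH[of "_ # xs" "Suc n"] Suc.prems by auto
  show ?case
    unfolding eqv_Suc_image prod.case
  proof (intro definable_and definable_ball[OF fin] definable_not)
    show "definable H A n (\<lambda>ys. sig xs = sig ys)" by (rule definable_sig[OF A Suc.prems(1)])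
    show "definable H A n (\<lambda>ys. \<exists>y\<in>verts H. p (y # ys))"
      if "p \<in> (\<lambda>x. eqv k (x # xs)) ` verts H" for p
      by (rule definable_ex[OF d[OF that]])
    have "definable H A (Suc n) (\<lambda>ys. \<not> (\<exists>p\<in>(\<lambda>x. eqv k (x # xs)) ` verts H. p ys))"
      by (rule definable_not[OF definable_bex[OF fin d]])
    from definable_ex[OF this]
    show "definable H A n (\<lambda>ys. \<exists>y\<in>verts H. \<not> (\<exists>p\<in>(\<lambda>x. eqv k (x # xs)) ` verts H. p (y # ys)))" .
  qed
qed

section \<open>Padding and positions of the game\<close>

text \<open>Repeating \<open>u\<close> forces the answer \<open>u'\<close>, because distance 0 is
  part of the signature. This spends one round on a padding entry.\<close>

lemma eqv_dup:
  assumes "eqv (Suc k) (xs @ [u]) (ys @ [u'])" "u \<in> verts H"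
  shows "eqv k (u # xs @ [u]) (u' # ys @ [u'])"
proof -
  obtain y where y: "eqv k (u # xs @ [u]) (y # ys @ [u'])" using assms by auto
  have s: "sig (u # xs @ [u]) = sig (y # ys @ [u'])" using eqv_sig[OF y] .
  have len: "length ys = length xs" using sigD(1)[OF s] by simp
  have "near H' 0 ((y # ys @ [u']) ! 0) ((y # ys @ [u']) ! Suc (length xs))"
    using sigD(3)[OF s, of 0 "Suc (length xs)" 0] by simp
  then have "y = u'" using len by (simp add: nth_append)
  then show ?thesis using y by simp
qed

lemma eqv_replicate:
  assumes "eqv (n + k) [u] [u']" "u \<in> verts H"
  shows "eqv k (replicate n u @ [u]) (replicate n u' @ [u'])"
  using assms(1)
proof (induction n arbitrary: k)
  case (Suc n)
  have "eqv (n + Suc k) [u] [u']" using Suc.prems by simp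
  from Suc.IH[OF this] show ?case using eqv_dup[OF _ assms(2)] by simp
qed simp

lemma sig_near_last:
  assumes "sig (xs @ [u]) = sig (ys @ [u'])" "i < length xs" "t \<le> T"
  shows "near H' t u' (ys ! i) \<longleftrightarrow> near H' t u (xs ! i)"
  using sigD(3)[OF assms(1), of "length xs" i t] sigD(1)[OF assms(1)] assms(2,3)
  by (simp add: nth_append)

text \<open>Positions of the game on \<open>(H, e)\<close> and \<open>(H, e')\<close>: within distance \<open>t\<close> of \<open>u\<close> and \<open>u'\<close> the
  players swap the two neighbourhoods, at distance more than \<open>t + 2 ^ k\<close> they copy moves.
  Entries of the lists \<open>x\<^sub>1\<close>, \<open>y\<^sub>1\<close>, \<open>x\<^sub>2\<close>, \<open>y\<^sub>2\<close> that do not come from a move in the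
  corresponding neighbourhood are padding.\<close>

definition pos :: "'a \<Rightarrow> 'a \<Rightarrow> nat \<Rightarrow> nat \<Rightarrow> 'a list \<Rightarrow> 'a list \<Rightarrow> 'a list \<Rightarrow> 'a list \<Rightarrow> 'a list \<Rightarrow> 'a list \<Rightarrow> bool" where
  "pos u u' k t e e' x1 y1 x2 y2 \<longleftrightarrow>
     u \<in> verts H \<and> u' \<in> verts H \<and> \<not> near H' (2 * T + 1) u u' \<and> t + 2 ^ k \<le> T \<and>
     set e \<subseteq> verts H \<and> set e' \<subseteq> verts H \<and>
     length e' = length e \<and> length x1 = length e \<and> length x2 = length e \<and>
     eqv k (x1 @ [u]) (y1 @ [u']) \<and> eqv k (x2 @ [u']) (y2 @ [u]) \<and>
     (\<forall>i<length e.
        e ! i = e' ! i \<and> \<not> near H' (t + 2 ^ k) u (e ! i) \<and> \<not> near H' (t + 2 ^ k) u' (e ! i) \<or>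
        e ! i = x1 ! i \<and> e' ! i = y1 ! i \<and> near H' t u (e ! i) \<or>
        e ! i = x2 ! i \<and> e' ! i = y2 ! i \<and> near H' t u' (e ! i))"

lemma nearS: "near H' r x y \<longleftrightarrow> near H' r y x"
  using near_sym[OF graph_H'] by blast

lemma posD:
  assumes "pos u u' k t e e' x1 y1 x2 y2"
  shows "u \<in> verts H" "u' \<in> verts H" "\<not> near H' (2 * T + 1) u u'" "t + 2 ^ k \<le> T"
    "set e \<subseteq> verts H" "set e' \<subseteq> verts H" "length e' = length e" "length x1 = length e"
    "length x2 = length e" "eqv k (x1 @ [u]) (y1 @ [u'])" "eqv k (x2 @ [u']) (y2 @ [u])"
    "length y1 = length e" "length y2 = length e"
  using assms sigD(1)[OF eqv_sig, of k "x1 @ [u]" "y1 @ [u']"]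
    sigD(1)[OF eqv_sig, of k "x2 @ [u']" "y2 @ [u]"]
  by (simp_all add: pos_def)

lemma pos_cases:
  assumes p: "pos u u' k t e e' x1 y1 x2 y2" and i: "i < length e"
  obtains
    (copy) "e ! i = e' ! i" "\<not> near H' (t + 2 ^ k) u (e ! i)" "\<not> near H' (t + 2 ^ k) u' (e ! i)"
  | (left) "e ! i = x1 ! i" "e' ! i = y1 ! i" "near H' t u (e ! i)" "near H' t u' (e' ! i)"
  | (right) "e ! i = x2 ! i" "e' ! i = y2 ! i" "near H' t u' (e ! i)" "near H' t u (e' ! i)"
proof -
  note d = posD[OF p]
  have t: "t \<le> T" using d(4) by simp
  have 1: "near H' t u' (y1 ! i) \<longleftrightarrow> near H' t u (x1 ! i)"
    using sig_near_last[OF eqv_sig[OF d(10)] _ t] i d(8) by simp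
  have 2: "near H' t u (y2 ! i) \<longleftrightarrow> near H' t u' (x2 ! i)"
    using sig_near_last[OF eqv_sig[OF d(11)] _ t] i d(9) by simp
  have "e ! i = e' ! i \<and> \<not> near H' (t + 2 ^ k) u (e ! i) \<and> \<not> near H' (t + 2 ^ k) u' (e ! i) \<or>
        e ! i = x1 ! i \<and> e' ! i = y1 ! i \<and> near H' t u (e ! i) \<or>
        e ! i = x2 ! i \<and> e' ! i = y2 ! i \<and> near H' t u' (e ! i)"
    using p i by (simp add: pos_def)
  then show thesis using 1 2 that by metis
qed

text \<open>Exchanging the boards exchanges the roles of the two neighbourhoods, so the second pair
  of lists comes first, reversed.\<close>

lemma pos_sym:
  assumes p: "pos u u' k t e e' x1 y1 x2 y2"
  shows "pos u u' k t e' e y2 x2 y1 x1"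
proof -
  note d = posD[OF p]
  have "e' ! i = e ! i \<and> \<not> near H' (t + 2 ^ k) u (e' ! i) \<and> \<not> near H' (t + 2 ^ k) u' (e' ! i) \<or>
        e' ! i = y2 ! i \<and> e ! i = x2 ! i \<and> near H' t u (e' ! i) \<or>
        e' ! i = y1 ! i \<and> e ! i = x1 ! i \<and> near H' t u' (e' ! i)" if "i < length e" for i
    using p that by (rule pos_cases) auto
  then show ?thesis using d eqv_sym[OF d(10)] eqv_sym[OF d(11)] by (simp add: pos_def)
qed

text \<open>Entries of one neighbourhood compare by signatures. Copied entries are farther than
  \<open>t + 1\<close> from both centres and so more than one step from any swapped entry; entries
  of different neighbourhoods are separated because \<open>u\<close> and \<open>u'\<close> are more
  than \<open>2 * T + 1\<close> apart.\<close>

lemma pos_near: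
  assumes p: "pos u u' k t e e' x1 y1 x2 y2" and i: "i < length e" and j: "j < length e" and s: "s \<le> 1"
  shows "near H' s (e' ! i) (e' ! j) \<longleftrightarrow> near H' s (e ! i) (e ! j)"
proof -
  note d = posD[OF p]
  have sT: "s \<le> T" using d(4) s by (metis add_leD2 one_le_numeral one_le_power order_trans)
  have far: "\<not> near H' s a b"
    if "near H' t c a" "\<not> near H' (t + 2 ^ k) c b" for a b c
  proof
    assume "near H' s a b"
    then have "near H' (t + s) c b" using that(1) near_trans by metis
    moreover have "t + s \<le> t + 2 ^ k" using s by (simp add: le_trans[OF s])
    ultimately show False using that(2) near_mono by metis
  qed
  have apart: "\<not> near H' s a b" if "near H' t u a" "near H' t u' b" for a b
  proof
    assume "near H' s a b"
    then have "near H' (t + s + t) u u'" using that nearS near_trans by metis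
    moreover have "t + s + t \<le> 2 * T + 1" using s d(4) by (simp add: mult_2)
    ultimately show False using d(3) near_mono by metis
  qed
  have 1: "near H' s (y1 ! i) (y1 ! j) \<longleftrightarrow> near H' s (x1 ! i) (x1 ! j)"
    using sigD(3)[OF eqv_sig[OF d(10)], of i j s] i j sT d by (simp add: nth_append)
  have 2: "near H' s (y2 ! i) (y2 ! j) \<longleftrightarrow> near H' s (x2 ! i) (x2 ! j)"
    using sigD(3)[OF eqv_sig[OF d(11)], of i j s] i j sT d by (simp add: nth_append)
  show ?thesis
    using p i
  proof (cases rule: pos_cases)
    case ci: copy
    from p j show ?thesis
    proof (cases rule: pos_cases)
      case copy
      with ci show ?thesis by simp
    next
      case left
      then show ?thesis using far[of u "e ! j" "e ! i"] far[of u' "e' ! j" "e' ! i"] ci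
          nearS[of s "e ! i"] nearS[of s "e' ! i"] by simp
    next
      case right
      then show ?thesis using far[of u' "e ! j" "e ! i"] far[of u "e' ! j" "e' ! i"] ci
          nearS[of s "e ! i"] nearS[of s "e' ! i"] by simp
    qed
  next
    case li: left
    from p j show ?thesis
    proof (cases rule: pos_cases)
      case copy
      then show ?thesis using far[of u "e ! i" "e ! j"] far[of u' "e' ! i" "e' ! j"] li by simp
    next
      case left
      then show ?thesis using li 1 by simp
    next
      case right
      then show ?thesis using apart[of "e ! i" "e ! j"] apart[of "e' ! j" "e' ! i"] li
          nearS[of s "e' ! i"] by simp
    qed
  next
    case ri: right
    from p j show ?thesis
    proof (cases rule: pos_cases)
      case copy
      then show ?thesis using far[of u' "e ! i" "e ! j"] far[of u "e' ! i" "e' ! j"] ri by simp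
    next
      case left
      then show ?thesis using apart[of "e ! j" "e ! i"] apart[of "e' ! i" "e' ! j"] ri
          nearS[of s "e ! i"] by simp
    next
      case right
      then show ?thesis using ri 2 by simp
    qed
  qed
qed

lemma pos_atype:
  assumes p: "pos u u' k t e e' x1 y1 x2 y2" and i: "i < length e"
  shows "atype H S (e' ! i) = atype H S (e ! i)"
proof -
  note d = posD[OF p]
  have 1: "atype H S (y1 ! i) = atype H S (x1 ! i)"
    using sigD(2)[OF eqv_sig[OF d(10)], of i] i d by (simp add: nth_append)
  have 2: "atype H S (y2 ! i) = atype H S (x2 ! i)"
    using sigD(2)[OF eqv_sig[OF d(11)], of i] i d by (simp add: nth_append)
  show ?thesis using p i by (cases rule: pos_cases) (use 1 2 in auto)
qed

text \<open>Types over \<open>S\<close> tell whether a pair of distinct vertices is flipped, so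
  adjacency in \<open>H\<close> is recovered from adjacency in \<open>H'\<close>.\<close>

lemma pos_adj:
  assumes p: "pos u u' k t e e' x1 y1 x2 y2" and i: "i < length e" and j: "j < length e"
  shows "adj H (e' ! i) (e' ! j) \<longleftrightarrow> adj H (e ! i) (e ! j)"
proof -
  note d = posD[OF p]
  have eq: "e' ! i = e' ! j \<longleftrightarrow> e ! i = e ! j" using pos_near[OF p i j, of 0] by simp
  have inH: "e ! i \<in> verts H" "e ! j \<in> verts H" "e' ! i \<in> verts H" "e' ! j \<in> verts H"
    using subsetD[OF d(5)] subsetD[OF d(6)] i j d(7) by auto
  show ?thesis
  proof (cases "e ! i = e ! j")
    case True
    then show ?thesis using eq graph_H by (simp add: is_graph_def)
  next
    case False
    have "near H' 1 x y \<longleftrightarrow> x = y \<or> adj H' x y" for x y by (auto simp: near_Suc)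
    then have "adj H' (e' ! i) (e' ! j) \<longleftrightarrow> adj H' (e ! i) (e ! j)"
      using pos_near[OF p i j, of 1] eq False by simp
    then show ?thesis
      using coherent_flipD[OF flip inH pos_atype[OF p i, symmetric] pos_atype[OF p j, symmetric]]
        False eq by auto
  qed
qed

text \<open>A move within \<open>t + 2 ^ k\<close> of \<open>u\<close> or \<open>u'\<close> is
  answered by the equivalence and enlarges \<open>t\<close> to \<open>t + 2 ^ k\<close>; any other
  move is copied. Earlier copied entries remain far since \<open>2 ^ k + 2 ^ k = 2 ^ Suc k\<close>.
  Lists that receive no real move spend their round on padding with \<open>u\<close> and
  \<open>u'\<close>.\<close>

lemma pos_step:
  assumes p: "pos u u' (Suc k) t e e' x1 y1 x2 y2" and x: "x \<in> verts H"
  obtains y t' x1' y1' x2' y2' where "y \<in> verts H" "pos u u' k t' (x # e) (y # e') x1' y1' x2' y2'"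
proof -
  note d = posD[OF p]
  have du: "eqv k (u # x1 @ [u]) (u' # y1 @ [u'])" by (rule eqv_dup[OF d(10,1)])
  have du': "eqv k (u' # x2 @ [u']) (u # y2 @ [u])" by (rule eqv_dup[OF d(11,2)])
  have near': "near H' (t + 2 ^ k) z w" if "near H' t z w" for z w
    using near_mono[OF that] by simp
  have far: "\<not> near H' (t + 2 ^ k) z w" if "\<not> near H' (t + 2 ^ Suc k) z w" for z w
    using that near_mono[of H' "t + 2 ^ k" z w "t + 2 ^ Suc k"] by auto
  have old: "\<forall>i<length e.
        e ! i = e' ! i \<and> \<not> near H' (t + 2 ^ Suc k) u (e ! i) \<and> \<not> near H' (t + 2 ^ Suc k) u' (e ! i) \<or>
        e ! i = x1 ! i \<and> e' ! i = y1 ! i \<and> near H' t u (e ! i) \<or>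
        e ! i = x2 ! i \<and> e' ! i = y2 ! i \<and> near H' t u' (e ! i)"
    using p by (simp add: pos_def)
  have gap: "t + 2 ^ k + 2 ^ k = t + 2 ^ Suc k" by simp
  have bd: "t + 2 ^ k + 2 ^ k \<le> T" "t + 2 ^ k \<le> T" using d(4) by simp_all
  have old': "\<forall>i<length e.
        e ! i = e' ! i \<and> \<not> near H' (t + 2 ^ k + 2 ^ k) u (e ! i) \<and> \<not> near H' (t + 2 ^ k + 2 ^ k) u' (e ! i) \<or>
        e ! i = x1 ! i \<and> e' ! i = y1 ! i \<and> near H' (t + 2 ^ k) u (e ! i) \<or>
        e ! i = x2 ! i \<and> e' ! i = y2 ! i \<and> near H' (t + 2 ^ k) u' (e ! i)"
    unfolding gap using old near' by blast
  consider "near H' (t + 2 ^ k) u x" | "near H' (t + 2 ^ k) u' x"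
    | "\<not> near H' (t + 2 ^ k) u x" "\<not> near H' (t + 2 ^ k) u' x" by blast
  then show thesis
  proof cases
    case 1
    obtain y where y: "y \<in> verts H" "eqv k (x # x1 @ [u]) (y # y1 @ [u'])" using d(10) x by auto
    have "pos u u' k (t + 2 ^ k) (x # e) (y # e') (x # x1) (y # y1) (u' # x2) (u # y2)"
      unfolding pos_def all_less_Suc_Cons
      using d(1-3,5-9,12,13) x y du' old' 1 bd by simp
    then show thesis using that y by blast
  next
    case 2
    obtain y where y: "y \<in> verts H" "eqv k (x # x2 @ [u']) (y # y2 @ [u])" using d(11) x by auto
    have "pos u u' k (t + 2 ^ k) (x # e) (y # e') (u # x1) (u' # y1) (x # x2) (y # y2)"
      unfolding pos_def all_less_Suc_Cons
      using d(1-3,5-9,12,13) x y du old' 2 bd by simp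
    then show thesis using that y by blast
  next
    case 3
    have "\<forall>i<length e.
        e ! i = e' ! i \<and> \<not> near H' (t + 2 ^ k) u (e ! i) \<and> \<not> near H' (t + 2 ^ k) u' (e ! i) \<or>
        e ! i = x1 ! i \<and> e' ! i = y1 ! i \<and> near H' t u (e ! i) \<or>
        e ! i = x2 ! i \<and> e' ! i = y2 ! i \<and> near H' t u' (e ! i)"
      using old far by blast
    then have "pos u u' k t (x # e) (x # e') (u # x1) (u' # y1) (u' # x2) (u # y2)"
      unfolding pos_def all_less_Suc_Cons
      using d(1-3,5-9,12,13) x du du' 3 bd by simp
    then show thesis using that x by blast
  qed
qed

lemma pos_holds:
  assumes "pos u u' k t e e' x1 y1 x2 y2" "qrank \<phi> \<le> k" "pure_fm \<phi>" "vars_below (length e) \<phi>"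
  shows "holds H e' \<phi> \<longleftrightarrow> holds H e \<phi>"
  using assms
proof (induction \<phi> arbitrary: k t e e' x1 y1 x2 y2)
  case (FEq i j)
  then show ?case using pos_near[OF FEq.prems(1), of i j 0] by simp
next
  case (FEdge i j)
  then show ?case using pos_adj[OF FEdge.prems(1), of i j] by simp
next
  case (FNot \<phi>)
  then show ?case using FNot.IH[OF FNot.prems(1)] by simp
next
  case (FAnd \<phi> \<psi>)
  then show ?case using FAnd.IH(1)[OF FAnd.prems(1)] FAnd.IH(2)[OF FAnd.prems(1)] by simp
next
  case (FEx \<phi>)
  then obtain l where k: "k = Suc l" "qrank \<phi> \<le> l" by (cases k) auto
  \<comment> \<open>Stated for arbitrary boards, so that \<open>pos_sym\<close> yields the other
    direction.\<close>
  have *: "\<exists>y\<in>verts H. holds H (y # f') \<phi>"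
    if p: "pos u u' (Suc l) t f f' z1 z2 z3 z4" and x: "x \<in> verts H" "holds H (x # f) \<phi>"
      "length f = length e" for f f' x z1 z2 z3 z4
  proof -
    obtain y t' a1 a2 a3 a4 where y: "y \<in> verts H" "pos u u' l t' (x # f) (y # f') a1 a2 a3 a4"
      by (rule pos_step[OF p x(1)])
    have "holds H (y # f') \<phi> \<longleftrightarrow> holds H (x # f) \<phi>"
      by (rule FEx.IH[OF y(2) k(2)]) (use FEx.prems x in auto)
    then show ?thesis using x y by blast
  qed
  have p: "pos u u' (Suc l) t e e' x1 y1 x2 y2" using FEx.prems k by simp
  show ?case
    using *[OF p] *[OF pos_sym[OF p]] posD(7)[OF p] by auto
qed simp

end

section \<open>From flip independence to nonforking\<close>

text \<open>A vertex \<open>u'\<close> of \<open>G\<close> is chosen that is game equivalent to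
  \<open>u\<close> and far from the parameters in \<open>G\<close>; it is far from \<open>v\<close>
  because \<open>v\<close> is far from all of \<open>G\<close>. So the game can start with
  \<open>u\<close> and \<open>u'\<close> swapped and \<open>b\<close> copied.\<close>

lemma (in stable_extension) finitely_satisfiable:
  assumes u: "u \<in> verts H - verts G" and v: "v \<in> verts H - verts G"
    and ind: "\<And>r. flip_indep r G H u v"
    and \<phi>: "pure_fm \<phi>" "vars_below (Suc (length b)) \<phi>" "set b \<subseteq> verts G \<union> {v}" "holds H (u # b) \<phi>"
  obtains u' where "u' \<in> verts G" "holds H (u' # b) \<phi>"
proof -
  define q where "q = qrank \<phi>"
  \<comment> \<open>\<open>2 ^ q\<close> is the radius needed at the start with
    \<open>t = 0\<close>, and \<open>M\<close> is the distance that must separate \<open>u\<close>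
    and \<open>u'\<close>.\<close>
  define T :: nat where "T = 2 ^ q"
  define M where "M = 2 * T + 1"
  \<comment> \<open>The given flip need not keep \<open>u\<close> and \<open>v\<close> away from
    \<open>G\<close>; the limit transfers its distance bound to a flip that does, at the cost of a
    factor 3.\<close>
  obtain S1 H1 where S1: "finite S1" "S1 \<subseteq> verts G" "coherent_flip H S1 H1" "\<not> near H1 (3 * M) u v"
    using ind[of "3 * M"] unfolding flip_indep_def definable_flip_iff gdist_gt_iff by blast
  have nl: "\<not> near limit M u v" using near_limit_flip[OF S1(3,1,2)] S1(4) by blast
  obtain S H' where S: "finite S" "S \<subseteq> verts G" "coherent_flip H S H'"
    and lim: "\<And>c x. c \<in> {u, v} \<Longrightarrow> near H' M c x \<longleftrightarrow> near limit M c x"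
    and farG: "\<And>c g. c \<in> {u, v} \<Longrightarrow> g \<in> verts G \<Longrightarrow> \<not> near H' M c g"
    by (rule separating_flip[of "{u, v}" M]) (use u v in auto)
  have uv: "\<not> near H' M u v" using lim nl by blast
  interpret flip_game H H' S T
    using graph S GH by unfold_locales auto
  \<comment> \<open>Besides the \<open>q\<close> rounds of the game, one round is spent on each
    padding entry for \<open>u # b\<close>.\<close>
  define l where "l = Suc (length b) + q"
  define R where "R e \<longleftrightarrow> eqv l [u] e \<and> (\<forall>g\<in>set b \<inter> verts G. \<not> near H' M (e ! 0) g)" for e
  have "definable H (verts G) 1 R"
    unfolding R_def
    by (intro definable_and definable_ball definable_not definable_eqv
        definable_bin_param[OF definable_near[OF S(3,1,2) GH]]) (use S GH u in auto)
  moreover have "R [u]" unfolding R_def using eqv_refl farG by auto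
  ultimately obtain e where e: "length e = 1" "set e \<subseteq> verts G" "R e"
    using elementary_reflect[OF elementary, of 1 R "[u]"] u by auto
  then obtain u' where "e = [u']" by (cases e) auto
  with e have u': "u' \<in> verts G" "eqv l [u] [u']" "\<And>g. g \<in> set b \<Longrightarrow> g \<in> verts G \<Longrightarrow> \<not> near H' M u' g"
    by (auto simp: R_def)
  let ?n = "Suc (length b)"
  have TM: "T \<le> M" by (simp add: M_def)
  have far: "\<not> near H' T u x \<and> \<not> near H' T u' x" if x: "x \<in> set b" for x
  proof -
    have "\<not> near H' M u x \<and> \<not> near H' M u' x"
    proof (cases "x \<in> verts G")
      case True
      then show ?thesis using farG u'(3) x by blast
    next
      case False
      then have "x = v" using x \<phi>(3) by blast
      then show ?thesis using uv farG[of v u'] u'(1) nearS by blast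
    qed
    then show ?thesis using near_mono TM by metis
  qed
  have "pos u u' q 0 (u # b) (u' # b) (replicate ?n u) (replicate ?n u') (replicate ?n u') (replicate ?n u)"
    unfolding pos_def all_less_Suc_Cons
  proof (intro conjI)
    show "eqv q (replicate ?n u @ [u]) (replicate ?n u' @ [u'])"
      using eqv_replicate[of ?n q u u'] u'(2) u unfolding l_def by blast
    show "eqv q (replicate ?n u' @ [u']) (replicate ?n u @ [u])"
      using eqv_replicate[of ?n q u' u] eqv_sym[OF u'(2)] u'(1) GH unfolding l_def by blast
    show "\<not> near H' (2 * T + 1) u u'" using farG[of u u'] u'(1) by (simp add: M_def)
    show "\<forall>i<length b.
        (u # b) ! Suc i = (u' # b) ! Suc i \<and> \<not> near H' (0 + 2 ^ q) u ((u # b) ! Suc i) \<and>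
        \<not> near H' (0 + 2 ^ q) u' ((u # b) ! Suc i) \<or>
        (u # b) ! Suc i = replicate ?n u ! Suc i \<and> (u' # b) ! Suc i = replicate ?n u' ! Suc i \<and>
        near H' 0 u ((u # b) ! Suc i) \<or>
        (u # b) ! Suc i = replicate ?n u' ! Suc i \<and> (u' # b) ! Suc i = replicate ?n u ! Suc i \<and>
        near H' 0 u' ((u # b) ! Suc i)"
      using far by (simp add: T_def)
  qed (use u v u'(1) GH \<phi>(3) in \<open>auto simp: T_def\<close>)
  from pos_holds[OF this _ \<phi>(1)] have "holds H (u' # b) \<phi>" using \<phi> by (simp add: q_def)
  then show thesis using that u'(1) by blast
qed

text \<open>The image of a vertex of \<open>G\<close> satisfying \<open>\<phi>\<close> satisfies a
  dividing disjunct. As its parameters \<open>c\<close> and every \<open>d i\<close> have the same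
  type over \<open>G\<close>, that image satisfies the whole family, against
  \<open>k\<close>-inconsistency.\<close>

lemma satisfiable_not_forks:
  assumes "u \<in> verts G" "verts G \<subseteq> verts H" "vars_below (Suc (length b)) \<phi>" "pure_fm \<phi>"
    "set b \<subseteq> verts H" "holds H (u # b) \<phi>"
  shows "\<not> forks_over H (verts G) (\<phi>, b)"
proof
  assume "forks_over H (verts G) (\<phi>, b)"
  then obtain N :: "('a \<times> nat) graph" and f \<Psi> where N: "elementary_embedding f H N"
    "\<Psi> \<subseteq> param_fms (verts N)" "\<forall>q\<in>\<Psi>. divides_in N (f ` verts G) q"
    "\<forall>x\<in>verts N. holds N (x # map f b) \<phi> \<longrightarrow> (\<exists>(\<psi>, c)\<in>\<Psi>. holds N (x # c) \<psi>)"
    unfolding forks_over_def by auto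
  have fu: "f u \<in> verts N" using N(1) assms by (auto simp: elementary_embedding_def)
  have "holds N (map f (u # b)) \<phi>"
    using N(1) assms unfolding elementary_embedding_def by (metis insert_subset length_Cons list.set(2) subsetD)
  then obtain \<psi> c where \<psi>: "(\<psi>, c) \<in> \<Psi>" "holds N (f u # c) \<psi>" using N(4) fu by auto
  have pf: "pure_fm \<psi>" "vars_below (Suc (length c)) \<psi>" using N(2) \<psi>(1) by (auto simp: param_fms_def)
  from N(3) \<psi>(1) have "divides_in N (f ` verts G) (\<psi>, c)" by blast
  then obtain d k where d: "\<And>i::nat. same_type_over N (f ` verts G) c (d i)"
    and k: "\<forall>I. finite I \<and> card I = k \<longrightarrow> \<not> (\<exists>x\<in>verts N. \<forall>i\<in>I. holds N (x # d i) \<psi>)"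
    unfolding divides_in_def by auto
  \<comment> \<open>\<open>g\<close> moves variable 0 behind \<open>c\<close>, the place where
    \<open>same_type_over\<close> puts elements of the base.\<close>
  define g where "g = case_nat (length c) id"
  have len: "length (d i) = length c" for i using d[of i] by (simp add: same_type_over_def)
  have move: "holds N (a @ [x]) (ren g \<psi>) \<longleftrightarrow> holds N (x # a) \<psi>" if "length a = length c" for a x
    by (rule holds_ren[OF pf(2)]) (use that in \<open>auto simp: g_def nth_append nth_Cons split: nat.split\<close>)
  have vb: "vars_below (length c + length [f u]) (ren g \<psi>)"
    by (rule vars_below_ren[OF pf(2)]) (auto simp: g_def split: nat.split)
  have "holds N (f u # d i) \<psi>" for i
  proof -
    have "\<forall>\<phi> a. pure_fm \<phi> \<and> set a \<subseteq> f ` verts G \<and> vars_below (length c + length a) \<phi> \<longrightarrow>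
        (holds N (c @ a) \<phi> \<longleftrightarrow> holds N (d i @ a) \<phi>)"
      using d[of i] unfolding same_type_over_def by blast
    from this[THEN spec[of _ "ren g \<psi>"], THEN spec[of _ "[f u]"]]
    have "holds N (c @ [f u]) (ren g \<psi>) \<longleftrightarrow> holds N (d i @ [f u]) (ren g \<psi>)"
      using vb pf(1) assms(1) by simp
    then show ?thesis using move[OF refl, of "f u"] move[OF len, of i "f u"] \<psi>(2) by simp
  qed
  then show False using k[THEN spec[of _ "{..<k}"]] fu by auto
qed

lemma (in stable_extension) flip_indep_imp_forking_indep:
  assumes "u \<in> verts H - verts G" "v \<in> verts H - verts G" "\<And>r. flip_indep r G H u v"
  shows "forking_indep G H u v"
  unfolding forking_indep_def type_forks_over_def
proof
  assume "\<exists>q\<in>tp H (verts G \<union> {v}) u. forks_over H (verts G) q"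
  then obtain \<phi> b where q: "(\<phi>, b) \<in> tp H (verts G \<union> {v}) u" "forks_over H (verts G) (\<phi>, b)" by auto
  then have \<phi>: "pure_fm \<phi>" "vars_below (Suc (length b)) \<phi>" "set b \<subseteq> verts G \<union> {v}" "holds H (u # b) \<phi>"
    by (auto simp: tp_def param_fms_def)
  obtain u' where u': "u' \<in> verts G" "holds H (u' # b) \<phi>"
    by (rule finitely_satisfiable[OF assms \<phi>])
  have "set b \<subseteq> verts H" using \<phi>(3) GH assms(2) by blast
  from satisfiable_not_forks[OF u'(1) GH \<phi>(2,1) this u'(2)] q(2) show False by blast
qed


section \<open>Skolem hulls in ultrapowers\<close>

text \<open>Zorn's lemma yields a minimal proper filter below \<open>F\<close>: the infimum of a
  nonempty chain stays proper, since what holds eventually for it does so for some member. By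
  minimality, a property compatible with the filter already belongs to it.\<close>

lemma ex_ultrafilter:
  fixes F :: "'i filter"
  assumes "F \<noteq> bot"
  obtains U where "U \<le> F" "U \<noteq> bot" "\<And>P. eventually P U \<or> eventually (\<lambda>x. \<not> P x) U"
proof -
  define A where "A = {U. U \<le> F \<and> U \<noteq> bot}"
  define R where "R = (\<lambda>x y :: 'i filter. y \<le> x)"
  have "\<exists>m\<in>A. \<forall>a\<in>A. R m a \<longrightarrow> a = m"
  proof (rule predicate_Zorn)
    show "partial_order_on A (relation_of R A)"
      by (rule partial_order_on_relation_ofI) (auto simp: R_def)
  next
    fix C assume C: "C \<in> Chains (relation_of R A)"
    then have CA: "C \<subseteq> A" by (auto simp: Chains_def relation_of_def)
    show "\<exists>u\<in>A. \<forall>a\<in>C. R a u"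
    proof (cases "C = {}")
      case True
      then show ?thesis using assms by (auto simp: A_def)
    next
      case False
      have "\<exists>x\<in>C. x \<le> inf a b" if "a \<in> C" "b \<in> C" for a b
      proof -
        have "a \<le> b \<or> b \<le> a" using C that by (auto simp: Chains_def relation_of_def R_def)
        then show ?thesis using that by (metis inf.absorb1 inf.absorb2 order_refl)
      qed
      then have ev: "eventually P (Inf C) \<longleftrightarrow> (\<exists>b\<in>C. eventually P b)" for P
        using False by (intro eventually_Inf_base) auto
      have "Inf C \<noteq> bot"
        unfolding trivial_limit_def ev using CA by (auto simp: A_def trivial_limit_def)
      moreover have "Inf C \<le> F" using False CA by (auto simp: A_def intro: Inf_lower2)
      ultimately show ?thesis by (auto simp: A_def R_def intro!: bexI[of _ "Inf C"] Inf_lower)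
    qed
  qed
  then obtain U where U: "U \<in> A" "\<And>a. a \<in> A \<Longrightarrow> a \<le> U \<Longrightarrow> a = U" unfolding R_def by blast
  show thesis
  proof (rule that[of U])
    fix P
    show "eventually P U \<or> eventually (\<lambda>x. \<not> P x) U"
    proof (rule disjCI)
      assume neg: "\<not> eventually (\<lambda>x. \<not> P x) U"
      have "inf U (principal {x. P x}) \<noteq> bot"
        using neg by (simp add: trivial_limit_def eventually_inf_principal)
      then have "inf U (principal {x. P x}) \<in> A" using U(1) by (auto simp: A_def intro: le_infI1)
      then have eq: "inf U (principal {x. P x}) = U" using U(2) by simp
      have "eventually P (inf U (principal {x. P x}))" by (simp add: eventually_inf_principal)
      then show "eventually P U" unfolding eq .
    qed
  qed (use U in \<open>auto simp: A_def\<close>)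
qed

instance fm :: countable
  by countable_datatype

text \<open>Skolem terms: \<open>SVar n\<close> names the sequence element with index
  \<open>n\<close>, and \<open>SApp \<phi> ts\<close> a witness for \<open>FEx \<phi>\<close> at
  \<open>ts\<close>.\<close>

datatype 'a sk = SConst 'a | SVar nat | SApp fm "'a sk list"

text \<open>With \<open>p\<close> as a pairing function, the number in the first component tags the
  constructor and the formula. The stored length makes the folded argument list decodable;
  \<open>undefined\<close> is filler.\<close>

primrec enc :: "(('a \<times> nat) \<times> ('a \<times> nat) \<Rightarrow> 'a \<times> nat) \<Rightarrow> 'a sk \<Rightarrow> 'a \<times> nat" where
  "enc p (SConst a) = p ((undefined, 0), (a, 0))"
| "enc p (SVar n) = p ((undefined, 1), (undefined, n))"
| "enc p (SApp \<phi> ts) = p ((undefined, Suc (Suc (to_nat \<phi>))),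
     p ((undefined, length ts), foldr (\<lambda>x y. p (x, y)) (map (enc p) ts) undefined))"

lemma foldr_pair_inj:
  assumes "inj p"
  shows "length xs = length ys \<Longrightarrow> foldr (\<lambda>x y. p (x, y)) xs b = foldr (\<lambda>x y. p (x, y)) ys b \<Longrightarrow> xs = ys"
  by (induction xs ys rule: list_induct2) (use assms in \<open>auto dest: injD\<close>)

lemma inj_enc:
  assumes p: "inj p"
  shows "inj (enc p)"
proof (rule injI)
  fix s t
  assume "enc p s = enc p t"
  then show "s = t"
  proof (induction s arbitrary: t)
    case (SConst a)
    then show ?case by (cases t) (auto dest!: injD[OF p])
  next
    case (SVar n)
    then show ?case by (cases t) (auto dest!: injD[OF p])
  next
    case (SApp \<phi> ts)
    show ?case
    proof (cases t)
      case (SApp \<psi> us)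
      have eq: "\<phi> = \<psi>" "length ts = length us"
        "foldr (\<lambda>x y. p (x, y)) (map (enc p) ts) undefined = foldr (\<lambda>x y. p (x, y)) (map (enc p) us) undefined"
        using SApp.prems unfolding SApp by (auto dest!: injD[OF p])
      have "map (enc p) ts = map (enc p) us" by (rule foldr_pair_inj[OF p _ eq(3)]) (simp add: eq(2))
      then have "ts = us" by (rule list.inj_map_strong[rotated]) (use SApp.IH in blast)
      then show ?thesis using eq SApp by simp
    qed (use SApp.prems in \<open>auto dest!: injD[OF p]\<close>)
  qed
qed

lemma ex_inj_sk:
  assumes "infinite (UNIV :: 'a set)"
  obtains h :: "'a sk \<Rightarrow> 'a \<times> nat" where "inj h"
proof -
  have "infinite (UNIV :: ('a \<times> nat) set)" using assms by (simp add: finite_prod)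
  from card_of_Times_same_infinite[OF this]
  obtain p :: "('a \<times> nat) \<times> ('a \<times> nat) \<Rightarrow> 'a \<times> nat" where "bij_betw p (UNIV \<times> UNIV) UNIV"
    using card_of_ordIso by blast
  then have "inj p" by (simp add: bij_betw_def)
  then show thesis using that inj_enc by blast
qed

text \<open>Restricting an ultrapower of \<open>H\<close> to the values of Skolem terms keeps its size small enough
  for it to live on the type \<open>'a \<times> nat\<close>.\<close>

locale ultrapower =
  fixes H :: "'a graph" and U :: "'i filter" and w :: "nat \<Rightarrow> 'i \<Rightarrow> 'a"
    and h :: "'a sk \<Rightarrow> 'a \<times> nat"
  assumes graph_H: "is_graph H" and nonempty: "verts H \<noteq> {}"
    and proper: "U \<noteq> bot" and ultra: "eventually P U \<or> eventually (\<lambda>x. \<not> P x) U"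
    and w: "w j i \<in> verts H" and h: "inj h"
begin

text \<open>Values are computed coordinatewise. Constants outside \<open>H\<close> and formulas
  without a witness get an arbitrary vertex, so every term denotes a vertex.\<close>

primrec ev :: "'i \<Rightarrow> 'a sk \<Rightarrow> 'a" where
  "ev i (SConst a) = (if a \<in> verts H then a else (SOME x. x \<in> verts H))"
| "ev i (SVar n) = w n i"
| "ev i (SApp \<phi> ts) = (SOME a. a \<in> verts H \<and>
     ((\<exists>b\<in>verts H. holds H (b # map (ev i) ts) \<phi>) \<longrightarrow> holds H (a # map (ev i) ts) \<phi>))"

lemma ev_SApp:
  "ev i (SApp \<phi> ts) \<in> verts H \<and>
    ((\<exists>b\<in>verts H. holds H (b # map (ev i) ts) \<phi>) \<longrightarrow> holds H (ev i (SApp \<phi> ts) # map (ev i) ts) \<phi>)"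
  unfolding ev.simps by (rule someI_ex) (use nonempty in blast)

lemma ev_verts: "ev i t \<in> verts H"
proof (cases t)
  case (SConst a)
  then show ?thesis using nonempty by (auto intro: someI_ex)
next
  case (SVar n)
  then show ?thesis using w by simp
next
  case (SApp \<phi> ts)
  then show ?thesis using ev_SApp by blast
qed

definition sim :: "'a sk \<Rightarrow> 'a sk \<Rightarrow> bool" where
  "sim s t \<longleftrightarrow> eventually (\<lambda>i. ev i s = ev i t) U"

lemma sim_refl: "sim t t" by (simp add: sim_def)

lemma sim_sym: "sim s t \<Longrightarrow> sim t s" by (simp add: sim_def eq_commute)

lemma sim_trans: "sim s t \<Longrightarrow> sim t r \<Longrightarrow> sim s r"
  unfolding sim_def by (erule (1) eventually_elim2) simp

definition emb :: "'a sk \<Rightarrow> 'a \<times> nat" where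
  "emb t = h (SOME s. sim s t)"

lemma emb_eq_iff: "emb s = emb t \<longleftrightarrow> sim s t"
proof
  assume "emb s = emb t"
  then have eq: "(SOME r. sim r s) = (SOME r. sim r t)" using h by (auto simp: emb_def dest: injD)
  have "sim (SOME r. sim r s) s" "sim (SOME r. sim r t) t"
    by (rule someI[of "\<lambda>r. sim r s" s, OF sim_refl], rule someI[of "\<lambda>r. sim r t" t, OF sim_refl])
  then show "sim s t" unfolding eq by (blast intro: sim_sym sim_trans)
next
  assume "sim s t"
  then have "sim r s \<longleftrightarrow> sim r t" for r by (blast intro: sim_sym sim_trans)
  then show "emb s = emb t" by (simp add: emb_def)
qed

definition N :: "('a \<times> nat) graph" where
  "N = \<lparr>verts = range emb,
     adj = \<lambda>a b. \<exists>s t. a = emb s \<and> b = emb t \<and> eventually (\<lambda>i. adj H (ev i s) (ev i t)) U\<rparr>"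

lemma adj_N: "adj N (emb s) (emb t) \<longleftrightarrow> eventually (\<lambda>i. adj H (ev i s) (ev i t)) U"
proof
  assume "adj N (emb s) (emb t)"
  then obtain s' t' where "sim s s'" "sim t t'" "eventually (\<lambda>i. adj H (ev i s') (ev i t')) U"
    by (auto simp: N_def emb_eq_iff)
  then show "eventually (\<lambda>i. adj H (ev i s) (ev i t)) U"
    unfolding sim_def by eventually_elim simp
qed (auto simp: N_def)

lemma graph_N: "is_graph N"
proof -
  have "\<not> adj N (emb s) (emb s)" for s
    using graph_H proper by (simp add: adj_N is_graph_def)
  moreover have "adj N (emb s) (emb t) \<Longrightarrow> adj N (emb t) (emb s)" for s t
    unfolding adj_N by (erule eventually_mono) (use graph_H in \<open>simp add: is_graph_def\<close>)
  moreover have "adj N x y \<Longrightarrow> x \<in> range emb \<and> y \<in> range emb" for x y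
    by (auto simp: N_def)
  ultimately show ?thesis unfolding is_graph_def by (fastforce simp: N_def)
qed

lemma ultra_not: "eventually (\<lambda>x. \<not> P x) U \<longleftrightarrow> \<not> eventually P U"
proof
  assume "eventually (\<lambda>x. \<not> P x) U"
  show "\<not> eventually P U"
  proof
    assume "eventually P U"
    with \<open>eventually (\<lambda>x. \<not> P x) U\<close> have "eventually (\<lambda>_. False) U" by eventually_elim simp
    then show False using proper by simp
  qed
qed (use ultra in blast)

text \<open>The theorem of Los for the hull. In the quantifier step the term
  \<open>SApp \<phi> ts\<close> picks witnesses at all coordinates at once, so the hull contains the
  required element.\<close>

lemma los:
  assumes "pure_fm \<phi>" "vars_below (length ts) \<phi>"
  shows "holds N (map emb ts) \<phi> \<longleftrightarrow> eventually (\<lambda>i. holds H (map (ev i) ts) \<phi>) U"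
  using assms
proof (induction \<phi> arbitrary: ts)
  case (FEq i j)
  then show ?case by (simp add: emb_eq_iff sim_def)
next
  case (FEdge i j)
  then show ?case by (simp add: adj_N)
next
  case (FNot \<phi>)
  then show ?case by (simp add: ultra_not)
next
  case (FAnd \<phi> \<psi>)
  then show ?case by (simp add: eventually_conj_iff)
next
  case (FEx \<phi>)
  have "holds N (map emb ts) (FEx \<phi>) \<longleftrightarrow> (\<exists>t. holds N (map emb (t # ts)) \<phi>)"
    by (auto simp: N_def)
  also have "\<dots> \<longleftrightarrow> (\<exists>t. eventually (\<lambda>i. holds H (map (ev i) (t # ts)) \<phi>) U)"
    using FEx.IH[of "_ # ts"] FEx.prems by simp
  also have "\<dots> \<longleftrightarrow> eventually (\<lambda>i. holds H (map (ev i) ts) (FEx \<phi>)) U"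
  proof
    assume "\<exists>t. eventually (\<lambda>i. holds H (map (ev i) (t # ts)) \<phi>) U"
    then obtain t where "eventually (\<lambda>i. holds H (map (ev i) (t # ts)) \<phi>) U" by blast
    then show "eventually (\<lambda>i. holds H (map (ev i) ts) (FEx \<phi>)) U"
      by (rule eventually_mono) (use ev_verts in auto)
  next
    assume "eventually (\<lambda>i. holds H (map (ev i) ts) (FEx \<phi>)) U"
    then have "eventually (\<lambda>i. holds H (map (ev i) (SApp \<phi> ts # ts)) \<phi>) U"
    proof (rule eventually_mono)
      fix i assume "holds H (map (ev i) ts) (FEx \<phi>)"
      then show "holds H (map (ev i) (SApp \<phi> ts # ts)) \<phi>"
        using ev_SApp[of i \<phi> ts] by (simp del: ev.simps)
    qed
    then show "\<exists>t. eventually (\<lambda>i. holds H (map (ev i) (t # ts)) \<phi>) U" by blast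
  qed
  finally show ?case .
qed simp

definition incl :: "'a \<Rightarrow> 'a \<times> nat" where
  "incl a = emb (SConst a)"

lemma map_ev_const: "set e \<subseteq> verts H \<Longrightarrow> map (ev i) (map SConst e) = e"
  by (induction e) auto

lemma map_incl: "map incl e = map emb (map SConst e)"
  by (simp add: incl_def)

lemma elementary_incl: "elementary_embedding incl H N"
  unfolding elementary_embedding_def
proof (intro conjI allI impI)
  show "incl ` verts H \<subseteq> verts N" by (auto simp: incl_def N_def)
next
  fix \<phi> e
  assume *: "pure_fm \<phi> \<and> vars_below (length e) \<phi> \<and> set e \<subseteq> verts H"
  then have "holds N (map incl e) \<phi> \<longleftrightarrow> eventually (\<lambda>i. holds H e \<phi>) U"
    unfolding map_incl by (subst los) (auto simp: map_ev_const simp del: map_map)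
  then show "holds H e \<phi> \<longleftrightarrow> holds N (map incl e) \<phi>" using proper by (simp add: eventually_const)
qed

end


section \<open>Dividing\<close>

text \<open>The earlier elements lie in \<open>G\<close>, so \<open>v\<close> itself satisfies all
  demands on the next one. These are definable over \<open>G\<close>, hence satisfied by a vertex of
  \<open>G\<close> too.\<close>

lemma (in stable_extension) coheir_sequence:
  assumes v: "v \<in> verts H" and Y: "finite Y" "Y \<subseteq> tp H (verts G) v"
    and B: "definable H (verts G) 2 (\<lambda>e. B (e ! 0) (e ! 1))" and nB: "\<And>g. g \<in> verts G \<Longrightarrow> \<not> B v g"
  obtains f :: "nat \<Rightarrow> 'a" where "\<And>j. f j \<in> verts G" "\<And>j \<theta> b. (\<theta>, b) \<in> Y \<Longrightarrow> holds H (f j # b) \<theta>"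
    "\<And>j k. k < j \<Longrightarrow> \<not> B (f j) (f k)"
proof -
  define P where "P f j x \<longleftrightarrow> x \<in> verts G \<and> (\<forall>y\<in>Y. holds H (x # snd y) (fst y)) \<and> (\<forall>k\<in>{..<j}. \<not> B x (f k))"
    for f :: "nat \<Rightarrow> 'a" and j x
  have "\<exists>f. \<forall>j. P f j (f j)"
  proof (rule dependent_wellorder_choice)
    fix x and f g :: "nat \<Rightarrow> 'a" and j :: nat
    assume "\<And>y. y < j \<Longrightarrow> f y = g y"
    then show "P f j x = P g j x" by (simp add: P_def)
  next
    fix j :: nat and f :: "nat \<Rightarrow> 'a"
    assume "\<And>y. y < j \<Longrightarrow> P f y (f y)"
    then have fG: "f k \<in> verts G" if "k < j" for k using that unfolding P_def by blast
    have "definable H (verts G) 1 (\<lambda>e. holds H (e ! 0 # snd y) (fst y))" if "y \<in> Y" for y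
    proof (rule definableI[of "fst y" _ "snd y"])
      show "pure_fm (fst y)" "vars_below (1 + length (snd y)) (fst y)" "set (snd y) \<subseteq> verts G"
        using that Y(2) by (force simp: tp_def param_fms_def)+
      fix e :: "'a list" assume "length e = 1"
      then obtain x where "e = [x]" by (cases e) auto
      then show "holds H (e ! 0 # snd y) (fst y) \<longleftrightarrow> holds H (e @ snd y) (fst y)" by simp
    qed
    then have dR: "definable H (verts G) 1 (\<lambda>e. (\<forall>y\<in>Y. holds H (e ! 0 # snd y) (fst y)) \<and>
        (\<forall>k\<in>{..<j}. \<not> B (e ! 0) (f k)))"
      by (intro definable_and definable_ball definable_not definable_bin_param[OF B])
        (use Y(1) fG GH in auto)
    have "\<forall>y\<in>Y. holds H (v # snd y) (fst y)" using Y(2) by (auto simp: tp_def)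
    moreover have "\<forall>k\<in>{..<j}. \<not> B v (f k)" using nB fG by blast
    ultimately obtain e where e: "length e = 1" "set e \<subseteq> verts G"
      "(\<forall>y\<in>Y. holds H (e ! 0 # snd y) (fst y)) \<and> (\<forall>k\<in>{..<j}. \<not> B (e ! 0) (f k))"
      using elementary_reflect[OF elementary dR, of "[v]"] v by auto
    then have "P f j (e ! 0)" unfolding P_def using nth_mem[of 0 e] by auto
    then show "\<exists>x. P f j x" by blast
  qed
  then obtain f where f: "\<And>j. P f j (f j)" by blast
  show thesis
    by (rule that[of f]) (use f in \<open>force simp: P_def\<close>)+
qed

text \<open>Each finite part \<open>Y\<close> of the type of \<open>v\<close> has a coheir sequence
  in \<open>G\<close> with distances above \<open>r + r\<close>. Their ultraproduct along the finite
  parts realises the full type at every place and keeps these distances. By the triangle inequality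
  no \<open>x\<close> is within \<open>r\<close> of two members, so the formula divides with
  \<open>k = 2\<close>.\<close>

lemma (in stable_extension) near_imp_forks:
  assumes u: "u \<in> verts H" and v: "v \<in> verts H - verts G"
    and S: "finite S" "S \<subseteq> verts G" and fl: "coherent_flip H S H'"
    and far: "\<And>g. g \<in> verts G \<Longrightarrow> \<not> near H' (r + r) v g" and uv: "near H' r u v"
  shows "\<not> forking_indep G H u v"
proof -
  have symH': "near H' n x y \<longleftrightarrow> near H' n y x" for n x y
    using near_sym[of H'] fl by (auto simp: coherent_flip_def)
  obtain \<phi> s where \<phi>: "pure_fm \<phi>" "vars_below (2 + length s) \<phi>" "set s \<subseteq> verts G"
    and \<phi>r: "\<And>e. length e = 2 \<Longrightarrow> set e \<subseteq> verts H \<Longrightarrow> near H' r (e ! 0) (e ! 1) \<longleftrightarrow> holds H (e @ s) \<phi>"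
    by (rule definableE[OF definable_near[OF fl S GH]], rule that)
  have \<phi>n: "holds H (x # y # s) \<phi> \<longleftrightarrow> near H' r x y" if "x \<in> verts H" "y \<in> verts H" for x y
    using \<phi>r[of "[x, y]"] that by simp
  have sH: "set s \<subseteq> verts H" using \<phi>(3) GH by blast
  define A where "A = tp H (verts G) v"
  define good where "good Y f \<longleftrightarrow> (\<forall>j. f j \<in> verts G) \<and> (\<forall>j. \<forall>(\<theta>, b)\<in>Y. holds H (f j # b) \<theta>) \<and>
      (\<forall>j k. k < j \<longrightarrow> \<not> near H' (r + r) (f j) (f k))" for Y and f :: "nat \<Rightarrow> 'a"
  have "\<exists>f. good Y f" if Y: "finite Y" "Y \<subseteq> A" for Y
  proof -
    obtain f :: "nat \<Rightarrow> 'a" where "\<And>j. f j \<in> verts G" "\<And>j \<theta> b. (\<theta>, b) \<in> Y \<Longrightarrow> holds H (f j # b) \<theta>"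
      "\<And>j k. k < j \<Longrightarrow> \<not> near H' (r + r) (f j) (f k)"
      by (rule coheir_sequence[OF _ Y[unfolded A_def] definable_near[OF fl S GH, of "r + r"] far])
        (use v in blast)+
    then have "good Y f" by (auto simp: good_def)
    then show ?thesis by blast
  qed
  then have "\<forall>Y. \<exists>f. finite Y \<and> Y \<subseteq> A \<longrightarrow> good Y f" by blast
  from choice[OF this] obtain F where F: "\<And>Y. finite Y \<Longrightarrow> Y \<subseteq> A \<Longrightarrow> good Y (F Y)" by blast
  define w where "w j Y = (if finite Y \<and> Y \<subseteq> A then F Y j else v)" for j Y
  have wH: "w j Y \<in> verts H" for j Y
    using F[of Y] v GH by (auto simp: w_def good_def)
  obtain U where U: "U \<le> finite_subsets_at_top A" "U \<noteq> bot"
    "\<And>P. eventually P U \<or> eventually (\<lambda>x. \<not> P x) U"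
    by (rule ex_ultrafilter[OF finite_subsets_at_top_neq_bot], rule that)
  have evU: "eventually P U" if "\<And>Y. finite Y \<Longrightarrow> X \<subseteq> Y \<Longrightarrow> Y \<subseteq> A \<Longrightarrow> P Y" "finite X" "X \<subseteq> A" for P X
    by (rule filter_leD[OF U(1)], unfold eventually_finite_subsets_at_top, rule exI[of _ X])
      (use that in blast)
  \<comment> \<open>If \<open>G\<close> were finite, a copy of \<open>v\<close> over all of
    \<open>G\<close> would be \<open>v\<close> itself. Infinity of the type is what the coding of
    terms requires.\<close>
  have inf: "infinite (UNIV :: 'a set)"
  proof
    assume "finite (UNIV :: 'a set)"
    then have "finite (verts G)" by (rule finite_subset[OF subset_UNIV])
    from approx[OF this subset_refl, of v] v obtain g
      where g: "g \<in> verts G" "atype H (verts G) g = atype H (verts G) v" by blast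
    then have "v = g" unfolding atype_eq_iff by auto
    then show False using v g by blast
  qed
  obtain h :: "'a sk \<Rightarrow> 'a \<times> nat" where h: "inj h" by (rule ex_inj_sk[OF inf])
  interpret ultrapower H U w h
    using graph v U wH h by unfold_locales auto
  \<comment> \<open>Only \<open>v\<close> varies along the sequence; the remaining parameters
    \<open>s\<close> lie in \<open>G\<close> and stay fixed.\<close>
  define c where "c = map incl (v # s)"
  define d where "d j = emb (SVar j) # map incl s" for j
  have d_emb: "d j @ map incl a = map emb (SVar j # map SConst (s @ a))" for j a
    by (simp add: d_def incl_def)
  have los_d: "holds N (d j @ map incl a) \<psi> \<longleftrightarrow> eventually (\<lambda>Y. holds H (w j Y # s @ a) \<psi>) U"
    if "pure_fm \<psi>" "vars_below (Suc (length s + length a)) \<psi>" "set a \<subseteq> verts H" for j a \<psi>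
  proof -
    have "map (ev Y) (SVar j # map SConst (s @ a)) = w j Y # s @ a" for Y
      using map_ev_const[of "s @ a" Y] sH that by simp
    then show ?thesis
      unfolding d_emb using that by (subst los) (simp_all del: map_append list.map)
  qed
  have wA: "eventually (\<lambda>Y. holds H (w j Y # b) \<theta>) U" if "(\<theta>, b) \<in> A" for j \<theta> b
  proof (rule evU[of "{(\<theta>, b)}"])
    fix Y assume Y: "finite Y" "{(\<theta>, b)} \<subseteq> Y" "Y \<subseteq> A"
    then show "holds H (w j Y # b) \<theta>" using F[OF Y(1,3)] by (auto simp: w_def good_def)
  qed (use that in auto)
  have same: "same_type_over N (incl ` verts G) c (d j)" for j
    unfolding same_type_over_def
  proof (intro conjI allI impI)
    show "length c = length (d j)" by (simp add: c_def d_def)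
  next
    fix \<psi> a'
    assume *: "pure_fm \<psi> \<and> set a' \<subseteq> incl ` verts G \<and> vars_below (length c + length a') \<psi>"
    then have "a' \<in> lists (incl ` verts G)" by auto
    then obtain a where a: "a' = map incl a" "set a \<subseteq> verts G" by (auto simp: lists_image)
    have pa: "pure_fm \<psi>" "vars_below (Suc (length (s @ a))) \<psi>" using * a by (auto simp: c_def)
    have aH: "set a \<subseteq> verts H" using a GH by blast
    have "c @ a' = map incl (v # s @ a)" by (simp add: c_def a)
    moreover have "holds H (v # s @ a) \<psi> \<longleftrightarrow> holds N (map incl (v # s @ a)) \<psi>"
      using elementary_incl pa aH sH v unfolding elementary_embedding_def
      by (metis DiffD1 Un_subset_iff insert_subset length_Cons list.set(2) set_append)
    ultimately have 1: "holds N (c @ a') \<psi> \<longleftrightarrow> holds H (v # s @ a) \<psi>" by simp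
    have 2: "holds N (d j @ a') \<psi> \<longleftrightarrow> eventually (\<lambda>Y. holds H (w j Y # s @ a) \<psi>) U"
      unfolding a(1) using los_d[OF pa(1) _ aH] pa(2) by simp
    have sa: "set (s @ a) \<subseteq> verts G" using a \<phi>(3) by simp
    \<comment> \<open>The type \<open>A\<close> is complete: it contains \<open>\<psi>\<close> or
      its negation, with these parameters.\<close>
    have "eventually (\<lambda>Y. holds H (w j Y # s @ a) \<psi>) U \<longleftrightarrow> holds H (v # s @ a) \<psi>"
    proof (cases "holds H (v # s @ a) \<psi>")
      case True
      then have "(\<psi>, s @ a) \<in> A" using pa sa by (simp add: A_def tp_def param_fms_def)
      then show ?thesis using wA True by simp
    next
      case False
      then have "(FNot \<psi>, s @ a) \<in> A" using pa sa by (simp add: A_def tp_def param_fms_def)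
      from wA[OF this] show ?thesis using False by (simp add: ultra_not)
    qed
    then show "holds N (c @ a') \<psi> \<longleftrightarrow> holds N (d j @ a') \<psi>" using 1 2 by simp
  qed
  have near_ev: "holds N (emb t # d j) \<phi> \<longleftrightarrow> eventually (\<lambda>Y. near H' r (ev Y t) (w j Y)) U" for t j
  proof -
    have "map (ev Y) (t # SVar j # map SConst s) = ev Y t # w j Y # s" for Y
      using map_ev_const[OF sH, of Y] by simp
    moreover have "emb t # d j = map emb (t # SVar j # map SConst s)" by (simp add: d_def incl_def)
    ultimately show ?thesis
      using los[of \<phi> "t # SVar j # map SConst s"] \<phi> \<phi>n[OF ev_verts wH] by simp
  qed
  have incons: "\<not> (holds N (x # d i) \<phi> \<and> holds N (x # d j) \<phi>)" if x: "x \<in> verts N" and ij: "i < j" for x i j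
  proof
    assume *: "holds N (x # d i) \<phi> \<and> holds N (x # d j) \<phi>"
    obtain t where "x = emb t" using x by (auto simp: N_def)
    then have "eventually (\<lambda>Y. near H' r (ev Y t) (w i Y)) U" "eventually (\<lambda>Y. near H' r (ev Y t) (w j Y)) U"
      using * near_ev by auto
    moreover have "eventually (\<lambda>Y. \<not> near H' (r + r) (w j Y) (w i Y)) U"
      by (rule evU[of "{}"]) (use F ij in \<open>auto simp: w_def good_def\<close>)
    ultimately have "eventually (\<lambda>_. False) U"
      by eventually_elim (use symH' near_trans in metis)
    then show False using U(2) by simp
  qed
  have "divides_in N (incl ` verts G) (\<phi>, c)"
    unfolding divides_in_def prod.case
  proof (intro exI[of _ d] exI[of _ "2::nat"] conjI allI impI)
    show "set (d i) \<subseteq> verts N" for i by (auto simp: d_def incl_def N_def)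
    show "same_type_over N (incl ` verts G) c (d i)" for i by (rule same)
    fix I :: "nat set" assume "finite I \<and> card I = 2"
    then obtain i j where I: "I = {i, j}" "i \<noteq> j" by (auto simp: card_2_iff)
    show "\<not> (\<exists>x\<in>verts N. \<forall>i\<in>I. holds N (x # d i) \<phi>)"
      using incons[of _ i j] incons[of _ j i] I by (metis insertCI linorder_neqE_nat)
  qed simp
  moreover have "(\<phi>, c) \<in> param_fms (verts N)"
    using \<phi> by (auto simp: param_fms_def c_def incl_def N_def)
  \<comment> \<open>The disjunction has a single member, the image of the formula itself in
    \<open>N\<close>.\<close>
  ultimately have "forks_over H (verts G) (\<phi>, v # s)"
    unfolding forks_over_def prod.case
    by (intro exI[of _ N] exI[of _ incl] exI[of _ "{(\<phi>, c)}"]) (auto simp: graph_N elementary_incl c_def)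
  moreover have "(\<phi>, v # s) \<in> tp H (verts G \<union> {v}) u"
    using \<phi> \<phi>n[of u v] u v uv by (auto simp: tp_def param_fms_def)
  ultimately show ?thesis unfolding forking_indep_def type_forks_over_def by blast
qed

theorem mainTheorem1:
  fixes G H :: "'a graph" and u v :: 'a
  assumes "is_graph G" and "is_graph H"
    and "elementary_substructure G H"
    and "monadically_stable G" and "monadically_stable H"
    and "u \<in> verts H - verts G" and "v \<in> verts H - verts G"
  shows "forking_indep G H u v \<longleftrightarrow> (\<forall>r. flip_indep r G H u v)"
proof -
  interpret stable_extension G H using assms by unfold_locales
  show ?thesis
  proof
    assume f: "forking_indep G H u v"
    show "\<forall>r. flip_indep r G H u v"
    proof (rule allI, rule ccontr)
      fix r assume neg: "\<not> flip_indep r G H u v"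
      \<comment> \<open>Failure of flip independence at \<open>r\<close> applies to this flip too,
        so \<open>u\<close> is within \<open>r\<close> of \<open>v\<close> where \<open>v\<close> is
        farther than \<open>r + r\<close> from \<open>G\<close>.\<close>
      obtain S H' where S: "finite S" "S \<subseteq> verts G" "coherent_flip H S H'"
        and far: "\<And>c g. c \<in> {v} \<Longrightarrow> g \<in> verts G \<Longrightarrow> \<not> near H' (r + r) c g"
        by (rule separating_flip[of "{v}" "r + r"]) (use assms(7) in auto)
      have "near H' r u v"
        using neg S unfolding flip_indep_def definable_flip_iff gdist_gt_iff by blast
      then show False using near_imp_forks[OF _ assms(7) S far] assms(6) f by blast
    qed
  next
    assume "\<forall>r. flip_indep r G H u v"
    then show "forking_indep G H u v"
      using flip_indep_imp_forking_indep[OF assms(6,7)] by blast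
  qed
qed

end
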